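(* Let $T:X\to E$ be a bounded linear operator from a Banach space $X$ to a Banach lattice $E$. Then the following statements are equivalent. (1) $T$ is disjointly weakly compact. (2) $\|T'f_n\|\to 0$ for each order bounded sequence $(f_n)\subset (E')^{+}$ satisfying $f_n\to 0$ in the weak$^*$ topology. (3) $\|T'f_n\|\to 0$ for each disjoint $L$-sequence $(f_n)\subset E'$ (such a sequence being automatically weak$^*$ null), i.e., $T$ is almost $(L)$ limited. (4) $\|T'f_n\|\to 0$ for each order bounded disjoint sequence $(f_n)\subset E'$, i.e., $T'$ is order weakly compact. (5) $\|T'f_n\|\to 0$ for each weak$^*$ null $L$-sequence $(f_n)\subset (E')^{+}$.
   Context: All Banach spaces and Banach lattices are real. $B_X$ is the closed unit ball of $X$, $E'$ the norm dual of $E$, $(E')^{+}$ its positive cone, and $T':E'\to X'$ the adjoint of $T$. A sequence $(x_n)$ in a Banach lattice is disjoint if $|x_n|\wedge|x_m|=0$ for $n\neq m$. $Sol(A)=\{x\in E: |x|\le |a| \text{ for some } a\in A\}$ is the solid hull of $A$. A norm bounded set $A\subset E$ is disjointly weakly compact if every disjoint sequence $(x_n)\subset Sol(A)$ converges weakly to zero. A bounded linear operator $T:X\to E$ is disjointly weakly compact if $T(B_X)$ is a disjointly weakly compact set in $E$. A norm bounded set $B\subset Y'$ ($Y$ a Banach space) is an $L$-set if $\sup_{f\in B}|f(y_n)|\to 0$ for every weakly null sequence $(y_n)$ in $Y$; a sequence $(f_n)\subset Y'$ is an $L$-sequence if $\{f_n:n\in\mathbb{N}\}$ is an $L$-set.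 $T:X\to E$ is almost $(L)$ limited if $\|T'f_n\|\to0$ for every disjoint weak$^*$ null $L$-sequence $(f_n)$ in $E'$. A bounded operator from a Banach lattice to a Banach space is order weakly compact if it maps order intervals to relatively weakly compact sets, equivalently, if it maps order bounded disjoint sequences to norm null sequences. *)

theory Defs
  imports "HOL-Analysis.Analysis" "HOL-Library.Lattice_Algebras" "HOL-Library.Lub_Glb"
begin

section \<open>Banach lattices and the dual order\<close>

class banach_lattice = banach + ordered_real_vector + lattice_ab_group_add_abs +
  assumes norm_mono_abs: "\<bar>x\<bar> \<le> \<bar>y\<bar> \<Longrightarrow> norm x \<le> norm y"

instance real :: banach_lattice
  by standard simp

text \<open>
  The norm dual of \<open>E\<close> is \<open>E \<Rightarrow>\<^sub>L real\<close>, ordered pointwise on the positive cone of \<open>E\<close>.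
\<close>

instantiation blinfun :: (banach_lattice, banach_lattice) ordered_real_vector
begin

definition less_eq_blinfun :: "('a \<Rightarrow>\<^sub>L 'b) \<Rightarrow> ('a \<Rightarrow>\<^sub>L 'b) \<Rightarrow> bool"
  where "f \<le> g \<longleftrightarrow> (\<forall>x\<ge>0. blinfun_apply f x \<le> blinfun_apply g x)"

definition less_blinfun :: "('a \<Rightarrow>\<^sub>L 'b) \<Rightarrow> ('a \<Rightarrow>\<^sub>L 'b) \<Rightarrow> bool"
  where "f < g \<longleftrightarrow> f \<le> g \<and> \<not> g \<le> (f :: 'a \<Rightarrow>\<^sub>L 'b)"

instance
proof
  fix f g h :: "'a \<Rightarrow>\<^sub>L 'b" and a b :: real
  show "f < g \<longleftrightarrow> f \<le> g \<and> \<not> g \<le> f"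
    by (rule less_blinfun_def)
  show "f \<le> f"
    by (simp add: less_eq_blinfun_def)
  show "f \<le> h" if "f \<le> g" "g \<le> h"
    using that unfolding less_eq_blinfun_def by (meson order_trans)
  show "f = g" if "f \<le> g" "g \<le> f"
  proof (rule blinfun_eqI)
    fix x :: 'a
    have pos: "blinfun_apply f y = blinfun_apply g y" if "y \<ge> 0" for y
      using that \<open>f \<le> g\<close> \<open>g \<le> f\<close> by (auto simp: less_eq_blinfun_def intro: order_antisym)
    have x: "x = pprt x - (- nprt x)"
      using prts[of x] by simp
    show "blinfun_apply f x = blinfun_apply g x"
      by (subst (1 2) x) (simp only: blinfun.diff_right pos zero_le_pprt neg_0_le_iff_le nprt_le_zero)
  qed
  show "h + f \<le> h + g" if "f \<le> g"
    using that by (simp add: less_eq_blinfun_def blinfun.add_left)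
  show "a *\<^sub>R f \<le> a *\<^sub>R g" if "f \<le> g" "0 \<le> a"
    using that by (simp add: less_eq_blinfun_def blinfun.scaleR_left scaleR_left_mono)
  show "a *\<^sub>R f \<le> b *\<^sub>R f" if "a \<le> b" "0 \<le> f"
    using that by (simp add: less_eq_blinfun_def blinfun.scaleR_left scaleR_right_mono)
qed

end

text \<open>
  Disjointness \<open>\<bar>x\<bar> \<sqinter> \<bar>y\<bar> = 0\<close>, with \<open>\<bar>x\<bar> = x \<squnion> -x\<close>, written with least upper and greatest
  lower bounds so that the same notion applies to a Banach lattice \<open>E\<close> and to its dual. The
  dual is a lattice (Riesz-Kantorovich), but \<open>E \<Rightarrow>\<^sub>L real\<close> is not an instance of class
  \<open>lattice\<close>, since bounded operators into an arbitrary Banach lattice do not form one.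
\<close>

definition lattice_disjoint :: "'a::{order,ab_group_add} \<Rightarrow> 'a \<Rightarrow> bool"
  where "lattice_disjoint x y \<longleftrightarrow>
    (\<exists>u v. isLub UNIV {x, - x} u \<and> isLub UNIV {y, - y} v \<and> isGlb UNIV {u, v} 0)"

lemma isLub_pair_iff: "isLub UNIV {x, y} u \<longleftrightarrow> u = sup x (y :: 'a::lattice)"
  by (auto simp: isLub_def leastP_def isUb_def setle_def setge_def intro: order_antisym)

lemma isGlb_pair_iff: "isGlb UNIV {x, y} u \<longleftrightarrow> u = inf x (y :: 'a::lattice)"
  by (auto simp: isGlb_def greatestP_def isLb_def setle_def setge_def intro: order_antisym)

lemma lattice_disjoint_iff: "lattice_disjoint x y \<longleftrightarrow> inf \<bar>x\<bar> \<bar>y\<bar> = (0 :: 'a::banach_lattice)"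
  by (auto simp: lattice_disjoint_def isLub_pair_iff isGlb_pair_iff abs_lattice)

definition disjoint_seq :: "(nat \<Rightarrow> 'a::{order,ab_group_add}) \<Rightarrow> bool"
  where "disjoint_seq x \<longleftrightarrow> (\<forall>m n. m \<noteq> n \<longrightarrow> lattice_disjoint (x n) (x m))"

definition order_bounded :: "'a::order set \<Rightarrow> bool"
  where "order_bounded A \<longleftrightarrow> (\<exists>a b. A \<subseteq> {a..b})"

definition solid_hull :: "'a::banach_lattice set \<Rightarrow> 'a set"
  where "solid_hull A = {x. \<exists>a\<in>A. \<bar>x\<bar> \<le> \<bar>a\<bar>}"

section \<open>Weak and weak* null sequences, L-sets, adjoints\<close>

definition weakly_null :: "(nat \<Rightarrow> 'a::real_normed_vector) \<Rightarrow> bool"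
  where "weakly_null x \<longleftrightarrow> (\<forall>\<phi> :: 'a \<Rightarrow>\<^sub>L real. (\<lambda>n. blinfun_apply \<phi> (x n)) \<longlonglongrightarrow> 0)"

definition weak_star_null :: "(nat \<Rightarrow> 'a::real_normed_vector \<Rightarrow>\<^sub>L real) \<Rightarrow> bool"
  where "weak_star_null f \<longleftrightarrow> (\<forall>x. (\<lambda>n. blinfun_apply (f n) x) \<longlonglongrightarrow> 0)"

text \<open>
  For nonempty \<open>B\<close> the supremum is that of a nonempty set which is bounded above, because
  \<open>B\<close> is norm bounded; only nonempty sets, namely ranges of sequences, are used below.
\<close>

definition L_set :: "('a::real_normed_vector \<Rightarrow>\<^sub>L real) set \<Rightarrow> bool"
  where "L_set B \<longleftrightarrow> bounded B \<and>
    (\<forall>y. weakly_null y \<longrightarrow> (\<lambda>n. SUP f\<in>B. \<bar>blinfun_apply f (y n)\<bar>) \<longlonglongrightarrow> 0)"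

definition L_sequence :: "(nat \<Rightarrow> 'a::real_normed_vector \<Rightarrow>\<^sub>L real) \<Rightarrow> bool"
  where "L_sequence f \<longleftrightarrow> L_set (range f)"

lift_definition banach_adjoint ::
  "('a::real_normed_vector \<Rightarrow>\<^sub>L 'b::real_normed_vector) \<Rightarrow> ('b \<Rightarrow>\<^sub>L real) \<Rightarrow>\<^sub>L ('a \<Rightarrow>\<^sub>L real)"
  is "\<lambda>T f. f o\<^sub>L T"
  by (rule bounded_bilinear.bounded_linear_left[OF bounded_bilinear_blinfun_compose])

section \<open>Classes of sets and operators\<close>

definition disjointly_weakly_compact_set :: "'a::banach_lattice set \<Rightarrow> bool"
  where "disjointly_weakly_compact_set A \<longleftrightarrow> bounded A \<and>
    (\<forall>x. disjoint_seq x \<and> range x \<subseteq> solid_hull A \<longrightarrow> weakly_null x)"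

definition disjointly_weakly_compact :: "('x::banach \<Rightarrow>\<^sub>L 'e::banach_lattice) \<Rightarrow> bool"
  where "disjointly_weakly_compact T \<longleftrightarrow>
    disjointly_weakly_compact_set (blinfun_apply T ` cball 0 1)"

definition almost_L_limited :: "('x::banach \<Rightarrow>\<^sub>L 'e::banach_lattice) \<Rightarrow> bool"
  where "almost_L_limited T \<longleftrightarrow>
    (\<forall>f :: nat \<Rightarrow> 'e \<Rightarrow>\<^sub>L real. disjoint_seq f \<and> weak_star_null f \<and> L_sequence f \<longrightarrow>
      (\<lambda>n. norm (blinfun_apply (banach_adjoint T) (f n))) \<longlonglongrightarrow> 0)"

text \<open>
  Order weak compactness in its sequential form: order bounded disjoint sequences are mapped
  to norm null sequences; equivalently, order intervals are mapped to relatively weakly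
  compact sets. It is meant for operators whose domain is a Banach lattice; the weaker sort
  admits the dual \<open>E \<Rightarrow>\<^sub>L real\<close> of a Banach lattice as domain.
\<close>

definition order_weakly_compact ::
  "('a::{real_normed_vector,order} \<Rightarrow>\<^sub>L 'y::real_normed_vector) \<Rightarrow> bool"
  where "order_weakly_compact S \<longleftrightarrow>
    (\<forall>x. order_bounded (range x) \<and> disjoint_seq x \<longrightarrow>
      (\<lambda>n. norm (blinfun_apply S (x n))) \<longlonglongrightarrow> 0)"

end

theory Submission
  imports Defs
begin

text \<open>
  If (1) holds and \<open>\<bar>f n (T (x n))\<bar> \<ge> e\<close> for some \<open>x n\<close> in the unit ball, while the moduli
  \<open>u n = \<bar>f n\<bar>\<close> are weak* null, then along a subsequence the vectors \<open>\<bar>T (x n)\<bar>\<close> can be cut down to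
  disjoint \<open>v n\<close> on which \<open>u n\<close> is still bounded away from 0. Every \<open>y\<close> with
  \<open>\<bar>y n\<bar> \<le> v n\<close> is weakly null by (1), which is impossible when \<open>f\<close> is an L-sequence and also
  when all \<open>u n\<close> lie below one functional. The moduli of a disjoint L-sequence are weak* null because
  otherwise disjoint vectors in some order interval would witness that it is not an L-sequence.

  Conversely, if \<open>y n\<close> are disjoint, \<open>\<bar>y n\<bar> \<le> \<bar>T (x n)\<bar>\<close> with \<open>x n\<close> in the unit ball, and
  \<open>\<phi> \<bar>y n\<bar>\<close> does not tend to 0 for some \<open>\<phi> \<ge> 0\<close>, then the components of \<open>\<phi>\<close> carried by the
  \<open>y n\<close>, with the signs of \<open>T (x n)\<close>, form an order bounded disjoint sequence whose image under the
  adjoint is not norm null; its positive and negative parts settle (2) and (5). Order bounded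
  disjoint sequences of functionals are L-sequences: they map a weakly null sequence to a weakly null
  sequence in \<open>l\<^sup>1\<close>, so the Schur property applies.
\<close>

section \<open>Order and norm in a Banach lattice\<close>

lemma norm_abs_lattice [simp]: "norm \<bar>x\<bar> = norm (x :: 'a::banach_lattice)"
  by (rule order_antisym; rule norm_mono_abs; simp)

lemma norm_mono_pos: "0 \<le> x \<Longrightarrow> x \<le> y \<Longrightarrow> norm x \<le> norm (y :: 'a::banach_lattice)"
  by (rule norm_mono_abs) simp

lemma norm_pprt_le: "norm (pprt x) \<le> norm (x :: 'a::banach_lattice)"
proof (rule norm_mono_abs)
  have "pprt x \<le> \<bar>x\<bar>" by (simp add: abs_prts)
  then show "\<bar>pprt x\<bar> \<le> \<bar>x\<bar>" by simp
qed

text \<open>The vector \<open>inverse c *\<^sub>R pprt (c *\<^sub>R x)\<close> is an upper bound of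
  \<open>x\<close> and 0, hence of \<open>pprt x\<close>.\<close>

lemma scaleR_pprt_le:
  fixes x :: "'a::banach_lattice"
  assumes "0 < c"
  shows "c *\<^sub>R pprt x \<le> pprt (c *\<^sub>R x)"
proof -
  have "pprt x \<le> inverse c *\<^sub>R pprt (c *\<^sub>R x)"
  proof -
    have "inverse c *\<^sub>R (c *\<^sub>R x) \<le> inverse c *\<^sub>R pprt (c *\<^sub>R x)"
      using assms by (intro scaleR_left_mono) (auto simp: pprt_def)
    moreover have "0 \<le> inverse c *\<^sub>R pprt (c *\<^sub>R x)"
      using assms by (intro scaleR_nonneg_nonneg) auto
    ultimately show ?thesis using assms by (auto simp: pprt_def)
  qed
  then have "c *\<^sub>R pprt x \<le> c *\<^sub>R (inverse c *\<^sub>R pprt (c *\<^sub>R x))"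
    using assms by (intro scaleR_left_mono) auto
  then show ?thesis using assms by simp
qed

text \<open>The negative part of the limit is dominated by \<open>\<bar>y - s n\<bar>\<close>, whose
  norm tends to 0, so the positive cone is closed.\<close>

lemma nonneg_LIMSEQ:
  fixes y :: "'a::banach_lattice"
  assumes lim: "s \<longlonglongrightarrow> y" and nn: "\<forall>\<^sub>F n in sequentially. 0 \<le> s n"
  shows "0 \<le> y"
proof -
  have *: "norm (inf y 0) \<le> norm (y - s n)" if "0 \<le> s n" for n
  proof (rule norm_mono_abs)
    have "- \<bar>y - s n\<bar> \<le> y - s n" by (metis abs_ge_minus_self minus_le_iff)
    also have "\<dots> \<le> y" using that by simp
    finally have "- \<bar>y - s n\<bar> \<le> inf y 0" by simp
    then show "\<bar>inf y 0\<bar> \<le> \<bar>y - s n\<bar>"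
      by (simp add: minus_le_iff)
  qed
  have "(\<lambda>n. norm (y - s n)) \<longlonglongrightarrow> norm (y - y)"
    by (intro tendsto_intros lim)
  then have "norm (inf y 0) \<le> 0"
    by (intro tendsto_lowerbound[where F = sequentially and f = "\<lambda>n. norm (y - s n)"])
      (use nn * in \<open>auto elim: eventually_mono\<close>)
  then have "inf y 0 = 0" by (simp only: norm_le_zero_iff)
  then show ?thesis by (simp add: inf.absorb_iff2)
qed

lemma term_le_suminf:
  fixes g :: "nat \<Rightarrow> 'a::banach_lattice"
  assumes "summable g" "\<And>i. 0 \<le> g i"
  shows "g k \<le> suminf g"
proof -
  have "(\<lambda>n. (\<Sum>i<n. g i) - g k) \<longlonglongrightarrow> suminf g - g k"
    by (intro tendsto_intros summable_LIMSEQ assms)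
  moreover have "\<forall>\<^sub>F n in sequentially. 0 \<le> (\<Sum>i<n. g i) - g k"
    using eventually_gt_at_top[of k]
    by eventually_elim (use sum_mono2[of "{..<_}" "{k}" g] assms in auto)
  ultimately have "0 \<le> suminf g - g k" by (rule nonneg_LIMSEQ)
  then show ?thesis by simp
qed

section \<open>Disjoint positive vectors\<close>

lemma inf_pprt_uminus:
  fixes d :: "'a::lattice_ab_group_add"
  shows "inf (pprt d) (pprt (- d)) = 0"
proof -
  have "pprt (- d) = pprt d - d"
    using add_sup_distrib_right[of d 0 "- d"] by (simp add: pprt_def sup_commute)
  then have "inf (pprt d) (pprt (- d)) = pprt d + inf 0 (- d)"
    by (simp add: add_inf_distrib_left)
  also have "inf 0 (- d) = - pprt d"
    by (simp add: pprt_def neg_sup_eq_inf inf_commute)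
  finally show ?thesis by simp
qed

lemma inf_eq_0_mono:
  fixes a :: "'a::lattice_ab_group_add"
  assumes "inf a b = 0" "0 \<le> a'" "a' \<le> a" "0 \<le> b'" "b' \<le> b"
  shows "inf a' b' = 0"
  using assms by (metis inf.bounded_iff inf_mono order_antisym)

text \<open>The right-hand side is the infimum of \<open>a + a\<close>, \<open>a + c\<close>,
  \<open>b + a\<close> and \<open>b + c\<close>, and each of these lies above
  \<open>inf a (b + c)\<close>.\<close>

lemma inf_add_le:
  fixes a :: "'a::lattice_ab_group_add"
  assumes "0 \<le> a" "0 \<le> b" "0 \<le> c"
  shows "inf a (b + c) \<le> inf a b + inf a c"
proof -
  have "inf a (b + c) \<le> inf (inf (a + a) (a + c)) (inf (b + a) (b + c))"
    using assms by (auto intro: le_infI1 le_infI2 add_increasing add_increasing2)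
  also have "\<dots> = inf a b + inf a c"
    by (simp add: add_inf_distrib_left add_inf_distrib_right inf_commute inf_assoc inf_left_commute add.commute)
  finally show ?thesis .
qed

lemma inf_sum_eq_0:
  fixes a :: "'a::lattice_ab_group_add"
  assumes "finite F" "0 \<le> a" "\<And>i. i \<in> F \<Longrightarrow> 0 \<le> b i" "\<And>i. i \<in> F \<Longrightarrow> inf a (b i) = 0"
  shows "inf a (sum b F) = 0"
  using assms
proof (induction F)
  case empty
  then show ?case by (simp add: inf_absorb2)
next
  case (insert i F)
  have "inf a (b i + sum b F) \<le> inf a (b i) + inf a (sum b F)"
    using insert.prems by (intro inf_add_le) (auto intro: sum_nonneg)
  also have "\<dots> = 0" using insert by simp
  finally have "inf a (b i + sum b F) \<le> 0" .
  moreover have "0 \<le> inf a (b i + sum b F)"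
    using insert.prems by (auto intro!: sum_nonneg add_nonneg_nonneg)
  ultimately show ?case using insert.hyps by simp
qed

text \<open>Since \<open>a + b = inf a b + sup a b\<close>, a sum of disjoint positive vectors is
  their supremum, and \<open>x\<close> is an upper bound of the terms.\<close>

lemma sum_disjoint_le:
  fixes b :: "nat \<Rightarrow> 'a::lattice_ab_group_add"
  assumes nn: "\<And>i. 0 \<le> b i" and le: "\<And>i. b i \<le> x" and dis: "\<And>i j. i \<noteq> j \<Longrightarrow> inf (b i) (b j) = 0"
  shows "(\<Sum>i<n. b i) \<le> x"
proof (induction n)
  case 0
  show ?case using order_trans[OF nn[of 0] le[of 0]] by simp
next
  case (Suc n)
  have "inf (b n) (\<Sum>i<n. b i) = 0"
    by (rule inf_sum_eq_0) (use nn dis in auto)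
  then have "sup (b n) (\<Sum>i<n. b i) = (\<Sum>i<Suc n. b i)"
    using add_eq_inf_sup[of "b n" "\<Sum>i<n. b i"] by (simp add: add.commute)
  then show ?case using Suc le by (metis le_sup_iff)
qed

lemma disjoint_seqI:
  fixes y v :: "nat \<Rightarrow> 'a::banach_lattice"
  assumes "\<And>m n. m < n \<Longrightarrow> inf (v m) (v n) = 0" "\<And>n. \<bar>y n\<bar> \<le> v n"
  shows "disjoint_seq y"
proof -
  have "inf \<bar>y m\<bar> \<bar>y n\<bar> = 0" if "m < n" for m n
    using inf_eq_0_mono[OF assms(1)[OF that], of "\<bar>y m\<bar>" "\<bar>y n\<bar>"] assms(2) by simp
  then show ?thesis
    unfolding disjoint_seq_def lattice_disjoint_iff by (metis inf_commute linorder_neqE_nat)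
qed

text \<open>
  The standard disjointification. If \<open>w\<close> dominates every \<open>c k *\<^sub>R a k\<close>, then for \<open>m < n\<close> the
  vectors below lie under positive multiples of \<open>(a m - a n / \<gamma>)\<^sup>+\<close> and \<open>(a n - \<gamma> a m)\<^sup>+\<close>.
\<close>

lemma disjointification:
  fixes a :: "nat \<Rightarrow> 'a::banach_lattice"
  assumes a: "\<And>k. 0 \<le> a k" and w: "\<And>k. c k *\<^sub>R a k \<le> w" "0 \<le> w"
    and \<eta>: "\<And>k. 0 < \<eta> k" and \<gamma>: "\<And>m n. m < n \<Longrightarrow> 1 \<le> \<gamma> n m"
    and prod: "\<And>m n. m < n \<Longrightarrow> 1 \<le> \<gamma> n m * (\<eta> m * c n)"
    and v: "\<And>k. v k = pprt (a k - (\<Sum>i<k. \<gamma> k i *\<^sub>R a i) - \<eta> k *\<^sub>R w)"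
    and mn: "m < n"
  shows "inf (v m) (v n) = 0"
proof -
  have g0: "0 \<le> \<gamma> k i" if "i < k" for k i using \<gamma>[OF that] by simp
  have g: "0 < \<gamma> n m" using \<gamma>[OF mn] by simp
  let ?d = "\<gamma> n m *\<^sub>R a m - a n"
  \<comment> \<open>Of everything subtracted in \<open>v n\<close>, the summand \<open>i = m\<close>
    is kept.\<close>
  have "v n \<le> pprt (- ?d)"
  proof -
    have "\<gamma> n m *\<^sub>R a m \<le> (\<Sum>i<n. \<gamma> n i *\<^sub>R a i)"
      using mn scaleR_nonneg_nonneg[OF g0 a] sum_mono2[of "{..<n}" "{m}" "\<lambda>i. \<gamma> n i *\<^sub>R a i"] by auto
    moreover have "0 \<le> \<eta> n *\<^sub>R w"
      by (rule scaleR_nonneg_nonneg[OF less_imp_le[OF \<eta>] w(2)])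
    ultimately have "(\<Sum>i<n. \<gamma> n i *\<^sub>R a i) + \<eta> n *\<^sub>R w \<ge> \<gamma> n m *\<^sub>R a m"
      by (simp add: add_increasing2)
    then have "a n - ((\<Sum>i<n. \<gamma> n i *\<^sub>R a i) + \<eta> n *\<^sub>R w) \<le> - ?d"
      by (simp add: algebra_simps)
    then show ?thesis unfolding v by (metis pprt_mono diff_diff_add)
  qed
  moreover have "v m \<le> pprt ?d"
  proof -
    \<comment> \<open>Here the term with \<open>w\<close> is kept: as \<open>w\<close> dominates
      \<open>c n *\<^sub>R a n\<close>, the earlier vector can be compared with a later one.\<close>
    have "v m \<le> pprt (a m - (\<eta> m * c n) *\<^sub>R a n)"
    proof -
      have "0 \<le> (\<Sum>i<m. \<gamma> m i *\<^sub>R a i)" using a g0 by (intro sum_nonneg scaleR_nonneg_nonneg) auto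
      moreover have "(\<eta> m * c n) *\<^sub>R a n \<le> \<eta> m *\<^sub>R w"
        using scaleR_left_mono[OF w(1)[of n], of "\<eta> m"] \<eta>[of m] by simp
      ultimately have "(\<eta> m * c n) *\<^sub>R a n \<le> (\<Sum>i<m. \<gamma> m i *\<^sub>R a i) + \<eta> m *\<^sub>R w"
        by (simp add: add_increasing)
      then have "a m - ((\<Sum>i<m. \<gamma> m i *\<^sub>R a i) + \<eta> m *\<^sub>R w) \<le> a m - (\<eta> m * c n) *\<^sub>R a n"
        by (rule diff_left_mono)
      then show ?thesis unfolding v by (metis pprt_mono diff_diff_add)
    qed
    moreover have "0 \<le> v m" unfolding v by simp
    ultimately have "v m \<le> \<gamma> n m *\<^sub>R pprt (a m - (\<eta> m * c n) *\<^sub>R a n)"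
      using \<gamma>[OF mn] by (metis order_trans scaleR_one scaleR_right_mono zero_le_pprt)
    also have "\<dots> \<le> pprt (\<gamma> n m *\<^sub>R (a m - (\<eta> m * c n) *\<^sub>R a n))"
      by (rule scaleR_pprt_le[OF g])
    also have "\<dots> \<le> pprt ?d"
    proof (rule pprt_mono)
      \<comment> \<open>After scaling by \<open>\<gamma> n m\<close>, the assumption
        \<open>prod\<close> says that the coefficient of \<open>a n\<close> is at least 1.\<close>
      have "1 *\<^sub>R a n \<le> (\<gamma> n m * (\<eta> m * c n)) *\<^sub>R a n"
        by (rule scaleR_right_mono[OF prod[OF mn] a])
      then show "\<gamma> n m *\<^sub>R (a m - (\<eta> m * c n) *\<^sub>R a n) \<le> ?d"
        by (simp add: scaleR_diff_right)
    qed
    finally show ?thesis .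
  qed
  ultimately show ?thesis
    using inf_eq_0_mono[OF inf_pprt_uminus[of ?d], of "v m" "v n"] by (simp add: v)
qed

section \<open>Positive functionals\<close>

lemma dual_le: "f \<le> g \<Longrightarrow> 0 \<le> x \<Longrightarrow> blinfun_apply f x \<le> blinfun_apply g x"
  for f g :: "'a::banach_lattice \<Rightarrow>\<^sub>L real"
  by (simp add: less_eq_blinfun_def)

lemma dual_nonneg: "0 \<le> f \<Longrightarrow> 0 \<le> x \<Longrightarrow> 0 \<le> blinfun_apply f x"
  for f :: "'a::banach_lattice \<Rightarrow>\<^sub>L real"
  using dual_le[of 0 f x] by simp

lemma dual_mono: "0 \<le> f \<Longrightarrow> x \<le> y \<Longrightarrow> blinfun_apply f x \<le> blinfun_apply f y"
  for f :: "'a::banach_lattice \<Rightarrow>\<^sub>L real"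
  using dual_nonneg[of f "y - x"] by (simp add: blinfun.diff_right)

text \<open>The estimate holds on the positive and on the negative part of \<open>x\<close> and adds
  up. Any common upper bound of \<open>f\<close> and \<open>- f\<close> serves as \<open>u\<close>,
  not only the modulus.\<close>

lemma dual_abs_le:
  fixes f u :: "'a::banach_lattice \<Rightarrow>\<^sub>L real"
  assumes "f \<le> u" "- f \<le> u"
  shows "\<bar>blinfun_apply f x\<bar> \<le> blinfun_apply u \<bar>x\<bar>"
proof -
  have p: "0 \<le> pprt x" "0 \<le> - nprt x" by auto
  have "blinfun_apply f x = blinfun_apply f (pprt x) - blinfun_apply f (- nprt x)"
    by (metis blinfun.diff_right diff_minus_eq_add prts)
  moreover have "blinfun_apply u \<bar>x\<bar> = blinfun_apply u (pprt x) + blinfun_apply u (- nprt x)"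
    by (metis blinfun.add_right abs_prts diff_conv_add_uminus)
  ultimately show ?thesis
    using dual_le[OF assms(1) p(1)] dual_le[OF assms(1) p(2)]
      dual_le[OF assms(2) p(1)] dual_le[OF assms(2) p(2)]
    by (simp add: blinfun.minus_left)
qed

lemma dual_modulus_nonneg:
  fixes f u :: "'a::banach_lattice \<Rightarrow>\<^sub>L real"
  assumes "f \<le> u" "- f \<le> u"
  shows "0 \<le> u"
  unfolding less_eq_blinfun_def
  using dual_le[OF assms(1)] dual_le[OF assms(2)] by (force simp: blinfun.minus_left)

lemma norm_dual_le:
  fixes f u :: "'a::banach_lattice \<Rightarrow>\<^sub>L real"
  assumes "f \<le> u" "- f \<le> u"
  shows "norm f \<le> norm u"
proof (rule norm_blinfun_bound)
  fix x
  have "norm (blinfun_apply f x) \<le> norm (blinfun_apply u \<bar>x\<bar>)"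
    using dual_abs_le[OF assms, of x] by simp
  also have "\<dots> \<le> norm u * norm \<bar>x\<bar>" by (rule norm_blinfun)
  finally show "norm (blinfun_apply f x) \<le> norm u * norm x" by simp
qed simp

text \<open>Every vector is a difference of two positive vectors of no larger norm. The differences
  of values on the cone define the extension, and the norm bound passes to it up to a factor
  2.\<close>

lemma additive_on_cone_extends:
  fixes \<phi> :: "'a::banach_lattice \<Rightarrow> real"
  assumes add: "\<And>x y. 0 \<le> x \<Longrightarrow> 0 \<le> y \<Longrightarrow> \<phi> (x + y) = \<phi> x + \<phi> y"
    and scale: "\<And>c x. 0 < c \<Longrightarrow> 0 \<le> x \<Longrightarrow> \<phi> (c *\<^sub>R x) = c * \<phi> x"
    and bd: "\<And>x. 0 \<le> x \<Longrightarrow> \<bar>\<phi> x\<bar> \<le> C * norm x"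
  shows "\<exists>g :: 'a \<Rightarrow>\<^sub>L real. \<forall>x\<ge>0. blinfun_apply g x = \<phi> x"
proof -
  define h where "h x = \<phi> (pprt x) - \<phi> (- nprt x)" for x
  \<comment> \<open>Additivity makes the value independent of the decomposition; linearity then
    follows by choosing convenient decompositions.\<close>
  have h: "h (a - b) = \<phi> a - \<phi> b" if "0 \<le> a" "0 \<le> b" for a b
  proof -
    have "pprt (a - b) + b = a + - nprt (a - b)"
      using prts[of "a - b"] by (simp add: algebra_simps)
    then have "\<phi> (pprt (a - b)) + \<phi> b = \<phi> a + \<phi> (- nprt (a - b))"
      using that by (metis add zero_le_pprt neg_0_le_iff_le nprt_le_zero)
    then show ?thesis by (simp add: h_def)
  qed
  have p0: "\<phi> 0 = 0" using add[of 0 0] by simp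
  have dec: "\<exists>a b. 0 \<le> a \<and> 0 \<le> b \<and> x = a - b \<and> norm a \<le> norm x \<and> norm b \<le> norm x" for x :: 'a
    using prts[of x] norm_pprt_le[of x] norm_pprt_le[of "- x"]
    by (intro exI[of _ "pprt x"] exI[of _ "- nprt x"]) (auto simp: pprt_neg)
  have "bounded_linear h"
  proof (rule bounded_linear_intro)
    fix x y :: 'a
    obtain a b a' b' where ab: "0 \<le> a" "0 \<le> b" "x = a - b" "0 \<le> a'" "0 \<le> b'" "y = a' - b'"
      using dec by metis
    have "x + y = (a + a') - (b + b')" using ab by simp
    then have "h (x + y) = \<phi> (a + a') - \<phi> (b + b')" using ab h[of "a + a'" "b + b'"] by (metis add_nonneg_nonneg)
    also have "\<dots> = h x + h y" using ab by (simp add: add h)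
    finally show "h (x + y) = h x + h y" .
  next
    fix c :: real and x :: 'a
    obtain a b where ab: "0 \<le> a" "0 \<le> b" "x = a - b" using dec by metis
    consider "c = 0" | "c > 0" | "c < 0" by linarith
    then show "h (c *\<^sub>R x) = c *\<^sub>R h x"
    proof cases
      case 1
      then show ?thesis using p0 by (simp add: h_def)
    next
      case 2
      have "c *\<^sub>R x = c *\<^sub>R a - c *\<^sub>R b" using ab by (simp add: scaleR_diff_right)
      then have "h (c *\<^sub>R x) = \<phi> (c *\<^sub>R a) - \<phi> (c *\<^sub>R b)" using ab 2 h[of "c *\<^sub>R a" "c *\<^sub>R b"]
        by (simp add: scaleR_nonneg_nonneg)
      moreover have "h x = \<phi> a - \<phi> b" using ab h by simp
      ultimately show ?thesis using ab(1,2) 2 by (simp add: scale right_diff_distrib)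
    next
      case 3
      have "c *\<^sub>R x = (- c) *\<^sub>R b - (- c) *\<^sub>R a" using ab by (simp add: scaleR_diff_right)
      moreover have "0 \<le> (- c) *\<^sub>R b" "0 \<le> (- c) *\<^sub>R a"
        using ab 3 by (auto intro!: scaleR_nonneg_nonneg simp del: scaleR_minus_left)
      ultimately have "h (c *\<^sub>R x) = \<phi> ((- c) *\<^sub>R b) - \<phi> ((- c) *\<^sub>R a)"
        by (simp only: h)
      also have "\<dots> = (- c) * \<phi> b - (- c) * \<phi> a"
        using ab 3 scale[of "- c" a] scale[of "- c" b] by simp
      also have "\<dots> = c * h x" using ab by (simp add: h right_diff_distrib)
      finally show ?thesis by simp
    qed
  next
    fix x :: 'a
    obtain a b where ab: "0 \<le> a" "0 \<le> b" "x = a - b" "norm a \<le> norm x" "norm b \<le> norm x"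
      using dec by metis
    have "\<bar>h x\<bar> \<le> \<bar>\<phi> a\<bar> + \<bar>\<phi> b\<bar>" using ab h by simp
    also have "\<dots> \<le> \<bar>C\<bar> * norm a + \<bar>C\<bar> * norm b"
      using bd[of a] bd[of b] ab
      by (intro add_mono) (auto intro: order_trans[OF _ mult_right_mono])
    also have "\<dots> \<le> \<bar>C\<bar> * norm x + \<bar>C\<bar> * norm x"
      using ab by (intro add_mono mult_left_mono) auto
    finally show "norm (h x) \<le> norm x * (2 * \<bar>C\<bar>)" by (simp add: algebra_simps)
  qed
  then have "blinfun_apply (Blinfun h) x = h x" for x by (simp add: bounded_linear_Blinfun_apply)
  moreover have "h x = \<phi> x" if "0 \<le> x" for x using h[of x 0] that p0 by simp
  ultimately show ?thesis by metis
qed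

section \<open>Parts of functionals carried by order ideals\<close>

text \<open>These sets are the positive cones of the order ideals.\<close>

definition ideal_cone :: "'a::banach_lattice set \<Rightarrow> bool"
  where "ideal_cone J \<longleftrightarrow> 0 \<in> J \<and> (\<forall>x\<in>J. 0 \<le> x) \<and> (\<forall>x\<in>J. \<forall>y\<in>J. x + y \<in> J) \<and>
    (\<forall>x\<in>J. \<forall>c>0. c *\<^sub>R x \<in> J) \<and> (\<forall>x\<in>J. \<forall>y. 0 \<le> y \<and> y \<le> x \<longrightarrow> y \<in> J)"

text \<open>The Riesz-Kantorovich formula: on the cone, \<open>g x\<close> is the supremum of
  \<open>f\<close> over the members of \<open>J\<close> below \<open>x\<close>, and the two
  conclusions express just that. The cone of all positive vectors yields the positive part of
  \<open>f\<close>; a principal ideal yields a component of a positive functional.\<close>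

lemma ideal_part_exists:
  fixes f :: "'a::banach_lattice \<Rightarrow>\<^sub>L real"
  assumes J: "ideal_cone J"
  obtains g :: "'a \<Rightarrow>\<^sub>L real" where
    "\<And>x z. 0 \<le> x \<Longrightarrow> z \<in> J \<Longrightarrow> z \<le> x \<Longrightarrow> blinfun_apply f z \<le> blinfun_apply g x"
    "\<And>x e. 0 \<le> x \<Longrightarrow> 0 < e \<Longrightarrow> \<exists>z\<in>J. z \<le> x \<and> blinfun_apply g x < blinfun_apply f z + e"
proof -
  have J0: "0 \<in> J" and Jp: "\<And>z. z \<in> J \<Longrightarrow> 0 \<le> z" and Ja: "\<And>x y. x \<in> J \<Longrightarrow> y \<in> J \<Longrightarrow> x + y \<in> J"
    and Js: "\<And>c x. x \<in> J \<Longrightarrow> 0 < c \<Longrightarrow> c *\<^sub>R x \<in> J"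
    and Jd: "\<And>x y. x \<in> J \<Longrightarrow> 0 \<le> y \<Longrightarrow> y \<le> x \<Longrightarrow> y \<in> J"
    using J unfolding ideal_cone_def by blast+
  define S where "S x = blinfun_apply f ` {z\<in>J. z \<le> x}" for x
  define \<phi> where "\<phi> x = Sup (S x)" for x
  have bnd: "\<bar>blinfun_apply f z\<bar> \<le> norm f * norm x" if "z \<in> J" "z \<le> x" for z x
  proof -
    have "\<bar>blinfun_apply f z\<bar> \<le> norm f * norm z" using norm_blinfun[of f z] by simp
    also have "\<dots> \<le> norm f * norm x"
      using that by (intro mult_left_mono norm_mono_pos Jp) auto
    finally show ?thesis .
  qed
  have bdd: "bdd_above (S x)" for x
    unfolding S_def bdd_above_def using bnd[of _ x] by (fastforce simp: abs_le_iff)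
  have up: "blinfun_apply f z \<le> \<phi> x" if "z \<in> J" "z \<le> x" for z x
    unfolding \<phi>_def using that by (intro cSup_upper bdd) (auto simp: S_def)
  have ne: "S x \<noteq> {}" if "0 \<le> x" for x using that J0 by (auto simp: S_def)
  have least: "\<phi> x \<le> B" if "0 \<le> x" "\<And>z. z \<in> J \<Longrightarrow> z \<le> x \<Longrightarrow> blinfun_apply f z \<le> B" for x B
    unfolding \<phi>_def using that by (intro cSup_least ne) (auto simp: S_def)
  have approx: "\<exists>z\<in>J. z \<le> x \<and> \<phi> x < blinfun_apply f z + e" if "0 \<le> x" "0 < e" for x e
  proof (rule ccontr)
    assume "\<not> ?thesis"
    then have "\<phi> x \<le> \<phi> x - e" by (intro least that) force
    then show False using that by simp
  qed
  have "\<exists>g :: 'a \<Rightarrow>\<^sub>L real. \<forall>x\<ge>0. blinfun_apply g x = \<phi> x"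
  proof (rule additive_on_cone_extends)
    fix x y :: 'a assume xy: "0 \<le> x" "0 \<le> y"
    have "\<phi> (x + y) \<le> \<phi> x + \<phi> y"
    proof (rule least)
      fix z assume z: "z \<in> J" "z \<le> x + y"
      \<comment> \<open>Riesz decomposition: \<open>z\<close> is split into a part below
        \<open>x\<close> and a part below \<open>y\<close>, both still in \<open>J\<close>.\<close>
      define z1 where "z1 = inf z x"
      have z1: "z1 \<in> J" "z1 \<le> x" using z xy Jp by (auto simp: z1_def intro: Jd)
      have "z - z1 = sup 0 (z - x)"
        by (simp add: z1_def diff_inf_eq_sup add_sup_distrib_left)
      then have z2: "0 \<le> z - z1" "z - z1 \<le> y"
        using z xy by (auto simp: diff_le_eq add.commute)
      have "z - z1 \<le> z" using Jp[OF z1(1)] by simp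
      then have "z - z1 \<in> J" using z z2 Jd by blast
      then have "blinfun_apply f z1 + blinfun_apply f (z - z1) \<le> \<phi> x + \<phi> y"
        using up z1 z2 by (intro add_mono) auto
      then show "blinfun_apply f z \<le> \<phi> x + \<phi> y" by (simp add: blinfun.diff_right)
    qed (use xy in simp)
    moreover have "\<phi> x + \<phi> y \<le> \<phi> (x + y)"
    proof (rule field_le_epsilon)
      fix e :: real assume "0 < e"
      then obtain z1 z2 where z: "z1 \<in> J" "z1 \<le> x" "\<phi> x < blinfun_apply f z1 + e/2"
        "z2 \<in> J" "z2 \<le> y" "\<phi> y < blinfun_apply f z2 + e/2"
        using approx[OF xy(1), of "e/2"] approx[OF xy(2), of "e/2"] by auto
      have "blinfun_apply f (z1 + z2) \<le> \<phi> (x + y)" using z by (intro up Ja add_mono) auto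
      then show "\<phi> x + \<phi> y \<le> \<phi> (x + y) + e" using z by (simp add: blinfun.add_right)
    qed
    ultimately show "\<phi> (x + y) = \<phi> x + \<phi> y" by simp
  next
    \<comment> \<open>Stated for all positive scalars, so that the case of \<open>inverse c\<close>
      gives the reverse inequality.\<close>
    have le: "c * \<phi> x \<le> \<phi> (c *\<^sub>R x)" if c: "0 < c" and x: "0 \<le> x" for c and x :: 'a
    proof -
      have "\<phi> x \<le> \<phi> (c *\<^sub>R x) / c"
      proof (rule least[OF x])
        fix z assume "z \<in> J" "z \<le> x"
        then have "blinfun_apply f (c *\<^sub>R z) \<le> \<phi> (c *\<^sub>R x)"
          using c by (intro up Js scaleR_left_mono) auto
        then show "blinfun_apply f z \<le> \<phi> (c *\<^sub>R x) / c"
          using c by (simp add: blinfun.scaleR_right field_simps)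
      qed
      then show ?thesis using c by (simp add: field_simps)
    qed
    fix c :: real and x :: 'a assume c: "0 < c" and x: "0 \<le> x"
    have "inverse c * \<phi> (c *\<^sub>R x) \<le> \<phi> (inverse c *\<^sub>R c *\<^sub>R x)"
      using c x by (intro le scaleR_nonneg_nonneg) auto
    then have "\<phi> (c *\<^sub>R x) \<le> c * \<phi> x" using c by (simp add: field_simps)
    then show "\<phi> (c *\<^sub>R x) = c * \<phi> x" using le[OF c x] by simp
  next
    fix x :: 'a assume x: "0 \<le> x"
    have "\<phi> x \<le> norm f * norm x"
      using bnd by (intro least x) (auto simp: abs_le_iff)
    moreover have "0 \<le> \<phi> x" using up[OF J0 x] by simp
    ultimately show "\<bar>\<phi> x\<bar> \<le> norm f * norm x" by simp
  qed
  then obtain g :: "'a \<Rightarrow>\<^sub>L real" where g: "\<And>x. 0 \<le> x \<Longrightarrow> blinfun_apply g x = \<phi> x" by blast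
  show thesis
    by (rule that[of g]) (use g up approx in auto)
qed

text \<open>With all positive vectors as \<open>J\<close>, the construction gives the positive part
  of \<open>f\<close>; the approximation property encodes its minimality.\<close>

lemma dual_pprt_exists:
  fixes f :: "'a::banach_lattice \<Rightarrow>\<^sub>L real"
  obtains p where "0 \<le> p" "f \<le> p"
    "\<And>x e. 0 \<le> x \<Longrightarrow> 0 < e \<Longrightarrow> \<exists>z. 0 \<le> z \<and> z \<le> x \<and> blinfun_apply p x < blinfun_apply f z + e"
proof -
  have J: "ideal_cone {z :: 'a. 0 \<le> z}"
    by (auto simp: ideal_cone_def scaleR_nonneg_nonneg)
  obtain p :: "'a \<Rightarrow>\<^sub>L real" where
    p: "\<And>x z. 0 \<le> x \<Longrightarrow> z \<in> {z. 0 \<le> z} \<Longrightarrow> z \<le> x \<Longrightarrow> blinfun_apply f z \<le> blinfun_apply p x"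
      "\<And>x e. 0 \<le> x \<Longrightarrow> 0 < e \<Longrightarrow> \<exists>z\<in>{z. 0 \<le> z}. z \<le> x \<and> blinfun_apply p x < blinfun_apply f z + e"
    using ideal_part_exists[OF J, where f = f] by blast
  have "0 \<le> p" using p(1)[of _ 0] by (simp add: less_eq_blinfun_def)
  moreover have "f \<le> p" using p(1) by (simp add: less_eq_blinfun_def)
  ultimately show thesis using that p(2) by auto
qed

text \<open>With \<open>p\<close> the positive part of \<open>f\<close>, the modulus is
  \<open>p + (p - f)\<close>, and \<open>z + z - x\<close> satisfies
  \<open>\<bar>z + z - x\<bar> \<le> x\<close> for \<open>z\<close> between 0 and
  \<open>x\<close>.\<close>

lemma dual_modulus_bound_exists:
  fixes f :: "'a::banach_lattice \<Rightarrow>\<^sub>L real"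
  obtains u where "f \<le> u" "- f \<le> u"
    "\<And>x e. 0 \<le> x \<Longrightarrow> 0 < e \<Longrightarrow> \<exists>y. \<bar>y\<bar> \<le> x \<and> blinfun_apply u x < blinfun_apply f y + e"
proof -
  obtain p where p: "0 \<le> p" "f \<le> p"
    "\<And>x e. 0 \<le> x \<Longrightarrow> 0 < e \<Longrightarrow> \<exists>z. 0 \<le> z \<and> z \<le> x \<and> blinfun_apply p x < blinfun_apply f z + e"
    using dual_pprt_exists by blast
  have "f \<le> p + (p - f)" using add_mono[OF p(2), of 0 "p - f"] p(2) by simp
  moreover have "- f \<le> p + (p - f)" using p(1) by (simp add: algebra_simps add_nonneg_nonneg)
  moreover have "\<exists>y. \<bar>y\<bar> \<le> x \<and> blinfun_apply (p + (p - f)) x < blinfun_apply f y + e"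
    if xe: "0 \<le> x" "0 < e" for x e
  proof -
    obtain z where z: "0 \<le> z" "z \<le> x" "blinfun_apply p x < blinfun_apply f z + e / 2"
      using p(3)[of x "e / 2"] xe by auto
    have "z + z - x \<le> x" using add_mono[OF z(2) z(2)] by (simp add: diff_le_eq)
    moreover have "- (z + z - x) \<le> x" using add_nonneg_nonneg[OF z(1) z(1)]
      by (simp only: minus_diff_eq diff_le_eq le_add_same_cancel1)
    ultimately have "\<bar>z + z - x\<bar> \<le> x" by (rule abs_leI)
    moreover have "blinfun_apply (p + (p - f)) x < blinfun_apply f (z + z - x) + e"
      using z(3) by (simp add: blinfun.add_left blinfun.diff_left blinfun.add_right blinfun.diff_right)
    ultimately show ?thesis by blast
  qed
  ultimately show thesis using that by blast
qed

section \<open>Disjoint functionals\<close>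

text \<open>
  The Riesz-Kantorovich form of \<open>inf u v = 0\<close> for positive functionals: every positive vector
  splits into a part where \<open>u\<close> is small and a part where \<open>v\<close> is small.
\<close>

definition dual_split :: "('a::banach_lattice \<Rightarrow>\<^sub>L real) \<Rightarrow> ('a \<Rightarrow>\<^sub>L real) \<Rightarrow> bool"
  where "dual_split u v \<longleftrightarrow> (\<forall>x\<ge>0. \<forall>e>0. \<exists>z. 0 \<le> z \<and> z \<le> x \<and>
    blinfun_apply u z + blinfun_apply v (x - z) < e)"

lemma dual_split_sym: "dual_split u v \<Longrightarrow> dual_split v u"
  unfolding dual_split_def
proof (intro allI impI)
  fix x :: 'a and e :: real
  assume *: "\<forall>x\<ge>0. \<forall>e>0. \<exists>z\<ge>0. z \<le> x \<and> blinfun_apply u z + blinfun_apply v (x - z) < e"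
    and "0 \<le> x" "0 < e"
  then obtain z where "0 \<le> z" "z \<le> x" "blinfun_apply u z + blinfun_apply v (x - z) < e" by blast
  then show "\<exists>z\<ge>0. z \<le> x \<and> blinfun_apply v z + blinfun_apply u (x - z) < e"
    by (intro exI[of _ "x - z"]) auto
qed

lemma dual_split_0: "dual_split u 0"
  unfolding dual_split_def by (auto intro!: exI[of _ 0])

text \<open>The supremum of the two splitting vectors works: \<open>u\<close> is small there because
  it is at most the sum of two small values, and the remainder lies below both old
  remainders.\<close>

lemma dual_split_add:
  fixes u v w :: "'a::banach_lattice \<Rightarrow>\<^sub>L real"
  assumes nn: "0 \<le> u" "0 \<le> v" "0 \<le> w" and "dual_split u v" "dual_split u w"
  shows "dual_split u (v + w)"
  unfolding dual_split_def
proof (intro allI impI)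
  fix x :: 'a and e :: real assume x: "0 \<le> x" and e: "0 < e"
  obtain y where y: "0 \<le> y" "y \<le> x" "blinfun_apply u y + blinfun_apply v (x - y) < e / 2"
    using assms(4) x e unfolding dual_split_def by (meson half_gt_zero)
  obtain z where z: "0 \<le> z" "z \<le> x" "blinfun_apply u z + blinfun_apply w (x - z) < e / 2"
    using assms(5) x e unfolding dual_split_def by (meson half_gt_zero)
  define t where "t = sup y z"
  have t: "0 \<le> t" "t \<le> x" "y \<le> t" "z \<le> t" using y z by (auto simp: t_def intro: le_supI1)
  have "t \<le> y + z" using y z by (simp add: t_def add_increasing add_increasing2)
  then have "blinfun_apply u t \<le> blinfun_apply u y + blinfun_apply u z"
    using dual_mono[OF nn(1)] by (metis blinfun.add_right)
  moreover have "blinfun_apply v (x - t) \<le> blinfun_apply v (x - y)"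
    "blinfun_apply w (x - t) \<le> blinfun_apply w (x - z)"
    using t by (auto intro!: dual_mono nn)
  ultimately have "blinfun_apply u t + blinfun_apply (v + w) (x - t) < e"
    using y(3) z(3) by (simp add: blinfun.add_left)
  then show "\<exists>z\<ge>0. z \<le> x \<and> blinfun_apply u z + blinfun_apply (v + w) (x - z) < e"
    using t by blast
qed

lemma dual_split_sum:
  fixes u :: "'a::banach_lattice \<Rightarrow>\<^sub>L real"
  assumes "finite F" "0 \<le> u" "\<And>i. i \<in> F \<Longrightarrow> 0 \<le> v i" "\<And>i. i \<in> F \<Longrightarrow> dual_split u (v i)"
  shows "dual_split u (sum v F)"
  using assms
proof (induction F)
  case empty
  then show ?case by (simp add: dual_split_0)
next
  case (insert i F)
  then show ?case by (auto intro!: dual_split_add sum_nonneg)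
qed

text \<open>A common lower bound is evaluated at \<open>x = z + (x - z)\<close>, being compared with
  \<open>u\<close> on the first piece and with \<open>v\<close> on the second.\<close>

lemma dual_split_isGlb:
  assumes "0 \<le> u" "0 \<le> v" "dual_split u v"
  shows "isGlb UNIV {u, v} 0"
  unfolding isGlb_def greatestP_def isLb_def setle_def setge_def
proof (intro conjI ballI UNIV_I)
  fix w assume "w \<in> Collect (\<lambda>x. (\<forall>y\<in>{u, v}. x \<le> y) \<and> x \<in> UNIV)"
  then have w: "w \<le> u" "w \<le> v" by auto
  show "w \<le> 0"
    unfolding less_eq_blinfun_def
  proof (intro allI impI)
    fix x :: 'a assume x: "0 \<le> x"
    have "blinfun_apply w x \<le> 0 + e" if e: "0 < e" for e :: real
    proof -
      obtain z where z: "0 \<le> z" "z \<le> x" "blinfun_apply u z + blinfun_apply v (x - z) < e"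
        using assms(3) x e unfolding dual_split_def by blast
      have "blinfun_apply w x = blinfun_apply w z + blinfun_apply w (x - z)"
        by (simp add: blinfun.diff_right)
      also have "\<dots> \<le> blinfun_apply u z + blinfun_apply v (x - z)"
        using z w by (intro add_mono dual_le) auto
      finally show ?thesis using z by simp
    qed
    then show "blinfun_apply w x \<le> blinfun_apply 0 x"
      using field_le_epsilon[of "blinfun_apply w x" 0] by simp
  qed
qed (use assms in auto)

text \<open>If \<open>p\<close> is the positive part of \<open>u - v\<close>, then
  \<open>u - p\<close> is a common lower bound, so \<open>u \<le> p\<close>. A vector that nearly
  attains \<open>p x\<close> is then the required splitting.\<close>

lemma isGlb_dual_split:
  assumes "isGlb UNIV {u, v} 0"
  shows "dual_split u v"
proof -
  obtain p where p: "0 \<le> p" "u - v \<le> p"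
    "\<And>x e. 0 \<le> x \<Longrightarrow> 0 < e \<Longrightarrow> \<exists>z. 0 \<le> z \<and> z \<le> x \<and> blinfun_apply p x < blinfun_apply (u - v) z + e"
    using dual_pprt_exists by blast
  have "u - p \<le> u" "u - p \<le> v" using p(1,2) by (auto simp: algebra_simps)
  moreover have "w \<le> 0" if "w \<le> u" "w \<le> v" for w
    using assms that by (auto simp: isGlb_def greatestP_def isLb_def setle_def setge_def)
  ultimately have "u - p \<le> 0" by blast
  then have up: "u \<le> p" by simp
  have "\<exists>z. 0 \<le> z \<and> z \<le> x \<and> blinfun_apply v z + blinfun_apply u (x - z) < e"
    if xe: "0 \<le> x" "0 < e" for x e
  proof -
    obtain z where z: "0 \<le> z" "z \<le> x" "blinfun_apply p x < blinfun_apply (u - v) z + e"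
      using p(3) xe by blast
    with dual_le[OF up xe(1)] show ?thesis
      by (intro exI[of _ z]) (simp add: blinfun.diff_left blinfun.diff_right)
  qed
  then have "dual_split v u" by (simp add: dual_split_def)
  then show ?thesis by (rule dual_split_sym)
qed

text \<open>An upper bound is tested against \<open>q - p\<close> on the piece where
  \<open>p\<close> is small and against \<open>p - q\<close> on the piece where \<open>q\<close> is
  small.\<close>

lemma dual_split_isLub:
  assumes nn: "0 \<le> p" "0 \<le> q" and split: "dual_split p q"
  shows "isLub UNIV {p - q, - (p - q)} (p + q)"
  unfolding isLub_def leastP_def isUb_def setle_def setge_def
proof (intro conjI ballI UNIV_I)
  fix h assume "h \<in> {p - q, - (p - q)}"
  then show "h \<le> p + q" using nn by (auto simp: less_eq_blinfun_def blinfun.bilinear_simps)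
next
  fix w assume "w \<in> Collect (\<lambda>x. (\<forall>y\<in>{p - q, - (p - q)}. y \<le> x) \<and> x \<in> UNIV)"
  then have w: "p - q \<le> w" "q - p \<le> w" by auto
  show "p + q \<le> w"
    unfolding less_eq_blinfun_def
  proof (intro allI impI)
    fix x :: 'a assume x: "0 \<le> x"
    show "blinfun_apply (p + q) x \<le> blinfun_apply w x"
    proof (rule field_le_epsilon)
      fix e :: real assume "0 < e"
      \<comment> \<open>Half of \<open>e\<close>, because the small terms are lost twice, once from
        each side.\<close>
      then obtain z where z: "0 \<le> z" "z \<le> x" "blinfun_apply p z + blinfun_apply q (x - z) < e / 2"
        using split x unfolding dual_split_def by (meson half_gt_zero)
      have "blinfun_apply (q - p) z + blinfun_apply (p - q) (x - z)
          \<le> blinfun_apply w z + blinfun_apply w (x - z)"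
        using z w by (intro add_mono dual_le) auto
      then show "blinfun_apply (p + q) x \<le> blinfun_apply w x + e"
        using z(3) by (simp add: blinfun.bilinear_simps)
    qed
  qed
qed

text \<open>Induction on \<open>F\<close>: \<open>u i\<close> is split off from the sum of the
  others, the piece \<open>x - z\<close> goes to \<open>i\<close>, and \<open>z\<close> is
  distributed among the rest. Each \<open>u i\<close> then has almost all of its value on its own
  piece.\<close>

lemma disjoint_functionals_split_vector:
  fixes u :: "'i \<Rightarrow> 'a::banach_lattice \<Rightarrow>\<^sub>L real"
  assumes "finite F" "\<And>i. i \<in> F \<Longrightarrow> 0 \<le> u i"
    and "\<And>i j. i \<in> F \<Longrightarrow> j \<in> F \<Longrightarrow> i \<noteq> j \<Longrightarrow> dual_split (u i) (u j)" and "0 \<le> x" "0 < e"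
  shows "\<exists>a. (\<forall>i\<in>F. 0 \<le> a i \<and> blinfun_apply (u i) (x - a i) \<le> e) \<and> sum a F \<le> x"
  using assms
proof (induction F arbitrary: x e)
  case empty
  then show ?case by simp
next
  case (insert i F)
  have "dual_split (u i) (sum u F)"
  proof (rule dual_split_sum)
    fix j assume "j \<in> F"
    moreover from this have "i \<noteq> j" using insert.hyps by auto
    ultimately show "dual_split (u i) (u j)" using insert.prems by simp
  qed (use insert in auto)
  then obtain z where z: "0 \<le> z" "z \<le> x"
    "blinfun_apply (u i) z + blinfun_apply (sum u F) (x - z) < e / 2"
    using insert.prems unfolding dual_split_def by (meson half_gt_zero)
  have u0: "0 \<le> blinfun_apply (u j) y" if "j \<in> insert i F" "0 \<le> y" for j y
    using insert.prems that by (intro dual_nonneg) auto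
  have uF: "blinfun_apply (u j) (x - z) \<le> blinfun_apply (sum u F) (x - z)" if "j \<in> F" for j
    using that insert.hyps u0 z unfolding blinfun.sum_left
    by (intro member_le_sum) auto
  have uF0: "0 \<le> blinfun_apply (sum u F) (x - z)"
    unfolding blinfun.sum_left using u0 z by (intro sum_nonneg) auto
  obtain a where a: "\<forall>j\<in>F. 0 \<le> a j \<and> blinfun_apply (u j) (z - a j) \<le> e / 2" "sum a F \<le> z"
    using insert.IH[of z "e / 2"] insert.prems z by auto
  define b where "b = a(i := x - z)"
  have "0 \<le> b j \<and> blinfun_apply (u j) (x - b j) \<le> e" if "j \<in> insert i F" for j
  proof (cases "j = i")
    case True
    then show ?thesis using z uF0 insert.prems by (simp add: b_def)
  next
    case False
    then have j: "j \<in> F" using that by simp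
    have "x - a j = (x - z) + (z - a j)" by simp
    then have "blinfun_apply (u j) (x - a j)
        = blinfun_apply (u j) (x - z) + blinfun_apply (u j) (z - a j)"
      by (metis blinfun.add_right)
    moreover have "0 \<le> blinfun_apply (u i) z" using u0 z by simp
    ultimately show ?thesis using False a(1) j uF[OF j] z(3)
      by (auto simp: b_def)
  qed
  moreover have "sum b (insert i F) \<le> x"
  proof -
    have "sum b F = sum a F" using insert.hyps by (intro sum.cong) (auto simp: b_def)
    then show ?thesis using insert.hyps a(2) by (simp add: b_def le_diff_eq algebra_simps)
  qed
  ultimately show ?case by blast
qed

text \<open>Up to \<open>d\<close>, the value of \<open>u i\<close> at \<open>x\<close> is its value
  at its own piece \<open>a i\<close>, hence at most that of \<open>\<phi>\<close>, and the pieces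
  sum to at most \<open>x\<close>.\<close>

lemma sum_disjoint_functionals_le:
  fixes u :: "'i \<Rightarrow> 'a::banach_lattice \<Rightarrow>\<^sub>L real"
  assumes F: "finite F" and nn: "\<And>i. i \<in> F \<Longrightarrow> 0 \<le> u i" and le: "\<And>i. i \<in> F \<Longrightarrow> u i \<le> \<phi>"
    and split: "\<And>i j. i \<in> F \<Longrightarrow> j \<in> F \<Longrightarrow> i \<noteq> j \<Longrightarrow> dual_split (u i) (u j)"
    and \<phi>: "0 \<le> \<phi>" and x: "0 \<le> x"
  shows "(\<Sum>i\<in>F. blinfun_apply (u i) x) \<le> blinfun_apply \<phi> x"
proof (rule field_le_epsilon)
  fix e :: real assume e: "0 < e"
  \<comment> \<open>The summand 1 covers the case of an empty \<open>F\<close>.\<close>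
  define d where "d = e / (real (card F) + 1)"
  have d: "0 < d" "real (card F) * d \<le> e" using e by (auto simp: d_def field_simps)
  obtain a where a: "\<And>i. i \<in> F \<Longrightarrow> 0 \<le> a i \<and> blinfun_apply (u i) (x - a i) \<le> d" "sum a F \<le> x"
  proof -
    have "\<exists>a. (\<forall>i\<in>F. 0 \<le> a i \<and> blinfun_apply (u i) (x - a i) \<le> d) \<and> sum a F \<le> x"
      by (rule disjoint_functionals_split_vector[OF F nn split x d(1)])
    then show thesis using that by blast
  qed
  have "(\<Sum>i\<in>F. blinfun_apply (u i) x) \<le> (\<Sum>i\<in>F. blinfun_apply \<phi> (a i) + d)"
  proof (rule sum_mono)
    fix i assume "i \<in> F"
    then show "blinfun_apply (u i) x \<le> blinfun_apply \<phi> (a i) + d"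
      using a(1)[of i] dual_le[OF le, of i "a i"] by (simp add: blinfun.diff_right)
  qed
  also have "\<dots> = blinfun_apply \<phi> (sum a F) + real (card F) * d"
    by (simp add: sum.distrib blinfun.sum_right)
  also have "\<dots> \<le> blinfun_apply \<phi> x + e"
    using dual_mono[OF \<phi> a(2)] d(2) by simp
  finally show "(\<Sum>i\<in>F. blinfun_apply (u i) x) \<le> blinfun_apply \<phi> x + e" .
qed

text \<open>Pairwise disjointness supplies moduli separately for each pair; uniqueness of least
  upper bounds turns them into one sequence.\<close>

lemma disjoint_seq_moduli:
  fixes f :: "nat \<Rightarrow> 'a::banach_lattice \<Rightarrow>\<^sub>L real"
  assumes "disjoint_seq f"
  obtains u where "\<And>n. isLub UNIV {f n, - f n} (u n)" "\<And>m n. m \<noteq> n \<Longrightarrow> dual_split (u m) (u n)"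
proof -
  have uniq: "u = v" if "isLub UNIV {g, - g} u" "isLub UNIV {g, - g} v"
    for g u v :: "'a \<Rightarrow>\<^sub>L real"
    using that by (intro order_antisym) (auto simp: isLub_def leastP_def isUb_def setle_def setge_def)
  have dis: "lattice_disjoint (f n) (f m)" if "m \<noteq> n" for m n
    using assms that unfolding disjoint_seq_def by blast
  have "\<exists>v. isLub UNIV {f n, - f n} v" for n
    \<comment> \<open>Any index other than \<open>n\<close> would do; it only provides
      existence.\<close>
    using dis[of "Suc n" n] unfolding lattice_disjoint_def by auto
  then obtain u where u: "\<And>n. isLub UNIV {f n, - f n} (u n)" by metis
  have "dual_split (u m) (u n)" if "m \<noteq> n" for m n
    using dis[of n m] that u uniq isGlb_dual_split unfolding lattice_disjoint_def by metis
  then show thesis using that u by blast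
qed

lemma isLub_modulusD:
  fixes f :: "'a::banach_lattice \<Rightarrow>\<^sub>L real"
  assumes "isLub UNIV {f, - f} u"
  shows "f \<le> u" "- f \<le> u" "\<And>w. f \<le> w \<Longrightarrow> - f \<le> w \<Longrightarrow> u \<le> w"
  using assms by (auto simp: isLub_def leastP_def isUb_def setle_def setge_def)

text \<open>The modulus \<open>u\<close> is least, so it lies below the upper bound for which the
  approximation is known.\<close>

lemma isLub_modulus_approx:
  fixes f :: "'a::banach_lattice \<Rightarrow>\<^sub>L real"
  assumes u: "isLub UNIV {f, - f} u" and "0 \<le> x" "0 < e"
  shows "\<exists>y. \<bar>y\<bar> \<le> x \<and> blinfun_apply u x < blinfun_apply f y + e"
proof -
  obtain w where w: "f \<le> w" "- f \<le> w"
    "\<And>x e. 0 \<le> x \<Longrightarrow> 0 < e \<Longrightarrow> \<exists>y. \<bar>y\<bar> \<le> x \<and> blinfun_apply w x < blinfun_apply f y + e"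
    using dual_modulus_bound_exists by blast
  have "blinfun_apply u x \<le> blinfun_apply w x"
    using isLub_modulusD(3)[OF u w(1,2)] assms(2) by (rule dual_le)
  then show ?thesis using w(3)[OF assms(2,3)] by (meson order_le_less_trans)
qed

section \<open>L-sequences\<close>

text \<open>The gliding hump argument behind the Schur property of \<open>l\<^sup>1\<close>.\<close>

lemma uniformly_null_if_subseries_null:
  fixes a :: "nat \<Rightarrow> nat \<Rightarrow> real"
  assumes rows: "\<And>n. (\<lambda>k. a n k) \<longlonglongrightarrow> 0"
    and cols: "\<And>k. summable (\<lambda>n. \<bar>a n k\<bar>)"
    and subseries: "\<And>S. (\<lambda>k. \<Sum>n. if n \<in> S then a n k else 0) \<longlonglongrightarrow> 0"
    and e: "0 < e"
  shows "\<forall>\<^sub>F k in sequentially. \<forall>n. \<bar>a n k\<bar> \<le> e"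
proof (rule ccontr)
  assume "\<not> ?thesis"
  then have ex: "\<exists>k\<ge>K. \<exists>n. e < \<bar>a n k\<bar>" for K
    unfolding eventually_sequentially by (meson not_le)
  \<comment> \<open>A state \<open>(N, n, k)\<close> records a hump in row \<open>n\<close> of
    column \<open>k\<close> with little mass in rows from \<open>N\<close> on. \<open>Q\<close>
    places the next hump at or beyond \<open>N\<close>, in a column with little mass in rows before
    \<open>N\<close>.\<close>
  define P where "P s \<longleftrightarrow> (case s of (N, n, k) \<Rightarrow> n < N \<and> k < N \<and> e < \<bar>a n k\<bar> \<and>
    (\<Sum>i. \<bar>a (i + N) k\<bar>) < e / 4)" for s :: "nat \<times> nat \<times> nat"
  define Q where "Q s s' \<longleftrightarrow> (case s of (N, _, _) \<Rightarrow> case s' of (_, n', k') \<Rightarrow>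
    N \<le> n' \<and> N \<le> k' \<and> (\<Sum>i<N. \<bar>a i k'\<bar>) < e / 4)" for s s' :: "nat \<times> nat \<times> nat"
  have step: "\<exists>s. P s \<and> (case s of (_, n', k') \<Rightarrow>
    N \<le> n' \<and> N \<le> k' \<and> (\<Sum>i<N. \<bar>a i k'\<bar>) < e / 4)" for N
  proof -
    have "(\<lambda>k. \<Sum>i<N. \<bar>a i k\<bar>) \<longlonglongrightarrow> (\<Sum>i<N. \<bar>0\<bar>)"
      by (intro tendsto_intros rows)
    then have "\<forall>\<^sub>F k in sequentially. (\<Sum>i<N. \<bar>a i k\<bar>) < e / 4"
      using e by (intro order_tendstoD) auto
    then obtain K where K: "\<And>k. K \<le> k \<Longrightarrow> (\<Sum>i<N. \<bar>a i k\<bar>) < e / 4"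
      unfolding eventually_sequentially by blast
    obtain k n where kn: "max K N \<le> k" "e < \<bar>a n k\<bar>" using ex by blast
    \<comment> \<open>The head of column \<open>k\<close> is below \<open>e / 4\<close>, so a large
      entry cannot sit there.\<close>
    have n: "N \<le> n"
    proof (rule ccontr)
      assume "\<not> N \<le> n"
      then have "\<bar>a n k\<bar> \<le> (\<Sum>i<N. \<bar>a i k\<bar>)"
        by (intro member_le_sum) auto
      then show False using K[of k] kn e by simp
    qed
    obtain M where M: "\<And>m. M \<le> m \<Longrightarrow> norm (\<Sum>i. \<bar>a (i + m) k\<bar>) < e / 4"
      using suminf_exist_split[OF _ cols, of "e / 4" k] e by auto
    define N' where "N' = max M (Suc (max n k))"
    have "(\<Sum>i. \<bar>a (i + N') k\<bar>) < e / 4" using M[of N'] by (simp add: N'_def)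
    moreover have "n < N'" "k < N'" by (auto simp: N'_def)
    ultimately have "P (N', n, k)" using kn by (simp add: P_def)
    then show ?thesis using n kn K[of k] by (intro exI[of _ "(N', n, k)"]) simp
  qed
  have "\<exists>s. \<forall>i. P (s i) \<and> Q (s i) (s (Suc i))"
  proof (rule dependent_nat_choice)
    show "\<exists>x. P x" using step[of 0] by blast
    show "\<exists>y. P y \<and> Q x y" for x using step[of "fst x"] by (cases x) (auto simp: Q_def)
  qed
  then obtain s where s: "\<And>i. P (s i)" "\<And>i. Q (s i) (s (Suc i))" by blast
  define N where "N i = fst (s i)" for i
  define n where "n i = fst (snd (s i))" for i
  define k where "k i = snd (snd (s i))" for i
  have seq: "n i < N i" "k i < N i" "e < \<bar>a (n i) (k i)\<bar>" "(\<Sum>j. \<bar>a (j + N i) (k i)\<bar>) < e / 4"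
    "N i \<le> n (Suc i)" "N i \<le> k (Suc i)" "(\<Sum>j<N i. \<bar>a j (k (Suc i))\<bar>) < e / 4" for i
    using s[of i] by (auto simp: P_def Q_def N_def n_def k_def split: prod.splits)
  have "mono N"
    using seq(1,5) by (intro mono_iff_le_Suc[THEN iffD2] allI) (meson le_less_trans less_imp_le)
  \<comment> \<open>Each block of rows between consecutive values of \<open>N\<close> contains
    exactly one hump row, so the subseries over \<open>range n\<close> meets no second large term
    there.\<close>
  have n_in: "j = Suc i" if "N i \<le> n j" "n j < N (Suc i)" for i j
  proof (rule ccontr)
    assume "j \<noteq> Suc i"
    then consider "j \<le> i" | "Suc (Suc i) \<le> j" by linarith
    then show False
    proof cases
      case 1
      then show False using monoD[OF \<open>mono N\<close> 1] seq(1)[of j] that by simp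
    next
      case 2
      then obtain j' where "j = Suc j'" "Suc i \<le> j'" by (cases j) auto
      then show False using monoD[OF \<open>mono N\<close>, of "Suc i" j'] seq(5)[of j'] that by simp
    qed
  qed
  define g where "g K m = (if m \<in> range n then a m K else 0)" for K m
  \<comment> \<open>The hump exceeds \<open>e\<close>, while head and tail of the subseries take
    away less than \<open>e / 4\<close> each.\<close>
  have big: "e / 2 < \<bar>suminf (g (k (Suc i)))\<bar>" for i
  proof -
    let ?K = "k (Suc i)" and ?n = "n (Suc i)" and ?M = "N (Suc i)"
    have gle: "\<bar>g K m\<bar> \<le> \<bar>a m K\<bar>" for m K by (simp add: g_def)
    have sg: "summable (\<lambda>m. \<bar>g ?K m\<bar>)"
      by (rule summable_comparison_test'[OF cols[of ?K]]) (simp add: gle)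
    have sg': "summable (\<lambda>m. \<bar>g ?K (m + ?M)\<bar>)" "summable (\<lambda>m. \<bar>a (m + ?M) ?K\<bar>)"
      using sg cols[of ?K] summable_iff_shift[of "\<lambda>m. \<bar>g ?K m\<bar>" ?M] summable_iff_shift[of "\<lambda>m. \<bar>a m ?K\<bar>" ?M]
      by auto
    have "suminf (g ?K) = (\<Sum>m. g ?K (m + ?M)) + sum (g ?K) {..<?M}"
      by (rule suminf_split_initial_segment) (use sg in \<open>rule summable_rabs_cancel\<close>)
    moreover have "\<bar>\<Sum>m. g ?K (m + ?M)\<bar> < e / 4"
    proof -
      have "\<bar>\<Sum>m. g ?K (m + ?M)\<bar> \<le> (\<Sum>m. \<bar>g ?K (m + ?M)\<bar>)" by (rule summable_rabs[OF sg'(1)])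
      also have "\<dots> \<le> (\<Sum>m. \<bar>a (m + ?M) ?K\<bar>)" by (intro suminf_le sg' gle)
      finally show ?thesis using seq(4)[of "Suc i"] by simp
    qed
    moreover have "sum (g ?K) {..<?M} = a ?n ?K + sum (g ?K) ({..<?M} - {?n})"
      using seq(1)[of "Suc i"] by (subst sum.remove[of _ ?n]) (auto simp: g_def)
    moreover have "\<bar>sum (g ?K) ({..<?M} - {?n})\<bar> < e / 4"
    proof -
      have "sum (g ?K) ({..<?M} - {?n}) = sum (g ?K) {..<N i}"
      proof (rule sum.mono_neutral_right)
        show "{..<N i} \<subseteq> {..<?M} - {?n}"
          using monoD[OF \<open>mono N\<close>, of i "Suc i"] seq(5)[of i] by auto
        show "\<forall>m\<in>{..<?M} - {?n} - {..<N i}. g ?K m = 0"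
        proof
          fix m assume m: "m \<in> {..<?M} - {?n} - {..<N i}"
          then have "m \<noteq> n j" for j using n_in[of i j] by auto
          then show "g ?K m = 0" by (auto simp: g_def)
        qed
      qed simp
      then have "\<bar>sum (g ?K) ({..<?M} - {?n})\<bar> \<le> (\<Sum>j<N i. \<bar>a j ?K\<bar>)"
        using gle by (auto intro: order_trans[OF sum_abs] sum_mono)
      then show ?thesis using seq(7)[of i] by simp
    qed
    ultimately show ?thesis using seq(3)[of "Suc i"] by linarith
  qed
  have "(\<lambda>K. \<bar>suminf (g K)\<bar>) \<longlonglongrightarrow> \<bar>0\<bar>"
    unfolding g_def by (intro tendsto_rabs subseries)
  then have "\<forall>\<^sub>F K in sequentially. \<bar>suminf (g K)\<bar> < e / 2"
    using e by (intro order_tendstoD) auto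
  then obtain K0 where K0: "\<And>K. K0 \<le> K \<Longrightarrow> \<bar>suminf (g K)\<bar> < e / 2"
    unfolding eventually_sequentially by blast
  have "i \<le> N i" for i
  proof (induction i)
    case (Suc i)
    then show ?case using seq(5)[of i] seq(1)[of "Suc i"] by simp
  qed simp
  then have "K0 \<le> k (Suc K0)" using seq(6)[of K0] order_trans by blast
  then show False using K0 big[of K0] by fastforce
qed

section \<open>L-sequences and order bounded disjoint sequences\<close>

lemma L_sequence_bounded:
  assumes "L_sequence f"
  obtains B where "\<And>n. norm (f n) \<le> B"
  using assms unfolding L_sequence_def L_set_def bounded_iff by auto

text \<open>The supremum over the range dominates every diagonal choice, so \<open>r\<close> may be
  an arbitrary index sequence, not necessarily increasing.\<close>

lemma L_sequenceD:
  assumes "L_sequence f" "weakly_null y"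
  shows "(\<lambda>k. blinfun_apply (f (r k)) (y k)) \<longlonglongrightarrow> 0"
proof -
  obtain B where B: "\<And>n. norm (f n) \<le> B" using L_sequence_bounded[OF assms(1)] by blast
  have lim: "(\<lambda>k. SUP g\<in>range f. \<bar>blinfun_apply g (y k)\<bar>) \<longlonglongrightarrow> 0"
    using assms unfolding L_sequence_def L_set_def by blast
  have "\<bar>blinfun_apply (f (r k)) (y k)\<bar> \<le> (SUP g\<in>range f. \<bar>blinfun_apply g (y k)\<bar>)" for k
  proof (rule cSUP_upper)
    show "bdd_above ((\<lambda>g. \<bar>blinfun_apply g (y k)\<bar>) ` range f)"
    proof (rule bdd_aboveI2)
      fix g assume "g \<in> range f"
      then have "norm g * norm (y k) \<le> B * norm (y k)" using B by (auto intro: mult_right_mono)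
      then show "\<bar>blinfun_apply g (y k)\<bar> \<le> B * norm (y k)" using norm_blinfun[of g "y k"] by simp
    qed
  qed simp
  then show ?thesis by (intro Lim_null_comparison[OF _ lim]) simp
qed

text \<open>The domination makes the map from \<open>y\<close> to the sequence of values
  \<open>f n y\<close> a bounded operator into \<open>l\<^sup>1\<close>. Weak nullness of the
  argument then becomes uniform smallness by the gliding hump.\<close>

lemma dominated_sums_L_sequence:
  fixes f :: "nat \<Rightarrow> 'a::banach_lattice \<Rightarrow>\<^sub>L real"
  assumes dom: "\<And>y N. (\<Sum>n<N. \<bar>blinfun_apply (f n) y\<bar>) \<le> blinfun_apply \<phi> \<bar>y\<bar>"
  shows "L_sequence f"
proof -
  have bd\<phi>: "blinfun_apply \<phi> \<bar>y\<bar> \<le> norm \<phi> * norm y" for y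
    using norm_blinfun[of \<phi> "\<bar>y\<bar>"] by simp
  have sm: "summable (\<lambda>n. \<bar>blinfun_apply (f n) y\<bar>)" for y
    by (rule bounded_imp_summable[where B = "blinfun_apply \<phi> \<bar>y\<bar>"])
      (use dom[of y "Suc _"] in \<open>simp_all only: lessThan_Suc_atMost abs_ge_zero\<close>)
  have nf: "norm (f n) \<le> norm \<phi>" for n
  proof (rule norm_blinfun_bound)
    fix y
    have "\<bar>blinfun_apply (f n) y\<bar> \<le> (\<Sum>n<Suc n. \<bar>blinfun_apply (f n) y\<bar>)"
      by (intro member_le_sum) auto
    then show "norm (blinfun_apply (f n) y) \<le> norm \<phi> * norm y"
      using order_trans[OF dom bd\<phi>] by (simp only: real_norm_def) (rule order_trans)
  qed simp
  have "(\<lambda>k. SUP g\<in>range f. \<bar>blinfun_apply g (y k)\<bar>) \<longlonglongrightarrow> 0" if y: "weakly_null y" for y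
  proof -
    have ev: "\<forall>\<^sub>F k in sequentially. \<forall>n. \<bar>blinfun_apply (f n) (y k)\<bar> \<le> e" if "0 < e" for e
    proof (rule uniformly_null_if_subseries_null)
      show "(\<lambda>k. blinfun_apply (f n) (y k)) \<longlonglongrightarrow> 0" for n
        using y unfolding weakly_null_def by blast
      fix S
      \<comment> \<open>Each subseries is itself a bounded functional of \<open>x\<close>, to which
        the weak nullness of \<open>y\<close> applies.\<close>
      define G where "G x = (\<Sum>n. if n \<in> S then blinfun_apply (f n) x else 0)" for x
      have sma: "summable (\<lambda>n. \<bar>if n \<in> S then blinfun_apply (f n) x else 0\<bar>)" for x
        by (rule summable_comparison_test'[OF sm[of x]]) simp
      then have smS: "summable (\<lambda>n. if n \<in> S then blinfun_apply (f n) x else 0)" for x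
        by (rule summable_rabs_cancel)
      have "bounded_linear G"
      proof (rule bounded_linear_intro)
        show "G (x + z) = G x + G z" for x z
          unfolding G_def suminf_add[OF smS smS]
          by (intro suminf_cong) (simp add: blinfun.add_right)
        show "G (c *\<^sub>R x) = c *\<^sub>R G x" for c x
          unfolding G_def using suminf_mult[OF smS, of c x]
          by (simp add: blinfun.scaleR_right if_distrib[of "(*) c"] cong: if_cong)
        show "norm (G x) \<le> norm x * norm \<phi>" for x
        proof -
          have "\<bar>G x\<bar> \<le> (\<Sum>n. \<bar>if n \<in> S then blinfun_apply (f n) x else 0\<bar>)"
            unfolding G_def by (rule summable_rabs[OF sma])
          also have "\<dots> \<le> (\<Sum>n. \<bar>blinfun_apply (f n) x\<bar>)"
            by (intro suminf_le sma sm) simp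
          also have "\<dots> \<le> blinfun_apply \<phi> \<bar>x\<bar>"
            by (intro suminf_le_const sm dom)
          finally show ?thesis using bd\<phi>[of x] by (simp add: mult.commute)
        qed
      qed
      then have "blinfun_apply (Blinfun G) x = G x" for x by (simp add: bounded_linear_Blinfun_apply)
      moreover have "(\<lambda>k. blinfun_apply (Blinfun G) (y k)) \<longlonglongrightarrow> 0"
        using y unfolding weakly_null_def by blast
      ultimately show "(\<lambda>k. \<Sum>n. if n \<in> S then blinfun_apply (f n) (y k) else 0) \<longlonglongrightarrow> 0"
        by (simp add: G_def)
    qed (use that sm in auto)
    show ?thesis
    proof (rule tendstoI)
      fix e :: real assume e: "0 < e"
      show "\<forall>\<^sub>F k in sequentially. dist (SUP g\<in>range f. \<bar>blinfun_apply g (y k)\<bar>) 0 < e"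
        using ev[OF half_gt_zero[OF e]]
      proof eventually_elim
        case (elim k)
        have "(SUP g\<in>range f. \<bar>blinfun_apply g (y k)\<bar>) \<le> e / 2"
          using elim by (intro cSUP_least) auto
        \<comment> \<open>One member of the range shows that the supremum is nonnegative.\<close>
        moreover have "\<bar>blinfun_apply (f 0) (y k)\<bar> \<le> (SUP g\<in>range f. \<bar>blinfun_apply g (y k)\<bar>)"
          using elim by (intro cSUP_upper bdd_aboveI2[where M = "e / 2"]) auto
        ultimately show ?case using e by simp
      qed
    qed
  qed
  moreover have "bounded (range f)" using nf by (auto simp: bounded_iff)
  ultimately show ?thesis unfolding L_sequence_def L_set_def by blast
qed

lemma order_bounded_dual_bound:
  fixes f :: "nat \<Rightarrow> 'a::banach_lattice \<Rightarrow>\<^sub>L real"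
  assumes "order_bounded (range f)"
  obtains \<phi> where "0 \<le> \<phi>" "\<And>n. f n \<le> \<phi>" "\<And>n. - f n \<le> \<phi>"
proof -
  obtain l h where lh: "\<And>n. l \<le> f n" "\<And>n. f n \<le> h"
    using assms unfolding order_bounded_def subset_iff atLeastAtMost_iff by blast
  obtain p where p: "0 \<le> p" "h \<le> p"
    by (rule dual_pprt_exists[of h]) (rule that; assumption)
  obtain q where q: "0 \<le> q" "- l \<le> q"
    by (rule dual_pprt_exists[of "- l"]) (rule that; assumption)
  have "f n \<le> p + q" for n
    using lh(2)[of n] p(2) add_mono[of "f n" p 0 q] q(1) by auto
  moreover have "- f n \<le> p + q" for n
  proof -
    have "- f n \<le> - l" using lh(1)[of n] by simp
    then have "- f n \<le> q" using q(2) by (rule order_trans)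
    from add_mono[OF p(1) this] show ?thesis by simp
  qed
  ultimately show thesis using that[of "p + q"] add_nonneg_nonneg[OF p(1) q(1)] by blast
qed

lemma order_bounded_disjoint_L_sequence:
  fixes f :: "nat \<Rightarrow> 'a::banach_lattice \<Rightarrow>\<^sub>L real"
  assumes "order_bounded (range f)" "disjoint_seq f"
  shows "L_sequence f"
proof -
  obtain \<phi> where \<phi>: "0 \<le> \<phi>" "\<And>n. f n \<le> \<phi>" "\<And>n. - f n \<le> \<phi>"
    using order_bounded_dual_bound[OF assms(1)] by blast
  obtain u where u: "\<And>n. isLub UNIV {f n, - f n} (u n)" "\<And>m n. m \<noteq> n \<Longrightarrow> dual_split (u m) (u n)"
    using disjoint_seq_moduli[OF assms(2)] by blast
  note ud = isLub_modulusD[OF u(1)]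
  show ?thesis
  proof (rule dominated_sums_L_sequence)
    fix y :: 'a and N
    have "(\<Sum>n<N. \<bar>blinfun_apply (f n) y\<bar>) \<le> (\<Sum>n<N. blinfun_apply (u n) \<bar>y\<bar>)"
      by (intro sum_mono dual_abs_le ud)
    also have "\<dots> \<le> blinfun_apply \<phi> \<bar>y\<bar>"
      by (rule sum_disjoint_functionals_le) (use ud \<phi> u(2) dual_modulus_nonneg[OF ud(1,2)] in auto)
    finally show "(\<Sum>n<N. \<bar>blinfun_apply (f n) y\<bar>) \<le> blinfun_apply \<phi> \<bar>y\<bar>" .
  qed
qed

text \<open>Partial sums of the \<open>v k\<close> stay below \<open>x\<close>, so a positive
  functional has summable values on them.\<close>

lemma order_bounded_disjoint_weakly_null:
  fixes y v :: "nat \<Rightarrow> 'a::banach_lattice"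
  assumes dis: "\<And>m n. m < n \<Longrightarrow> inf (v m) (v n) = 0" and le: "\<And>k. v k \<le> x"
    and y: "\<And>k. \<bar>y k\<bar> \<le> v k"
  shows "weakly_null y"
  unfolding weakly_null_def
proof
  fix \<phi> :: "'a \<Rightarrow>\<^sub>L real"
  obtain w where w: "\<phi> \<le> w" "- \<phi> \<le> w"
    by (rule dual_modulus_bound_exists[of \<phi>]) (rule that; assumption)
  have w0: "0 \<le> w" by (rule dual_modulus_nonneg[OF w])
  have v0: "0 \<le> v k" for k using y[of k] abs_ge_zero order_trans by blast
  have dis': "inf (v i) (v j) = 0" if "i \<noteq> j" for i j
    using dis that by (metis inf_commute linorder_neqE_nat)
  have "summable (\<lambda>k. blinfun_apply w (v k))"
  proof (rule bounded_imp_summable)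
    show "0 \<le> blinfun_apply w (v k)" for k using w0 v0 by (rule dual_nonneg)
    show "(\<Sum>k\<le>n. blinfun_apply w (v k)) \<le> blinfun_apply w x" for n
      using dual_mono[OF w0 sum_disjoint_le[of v x "Suc n", OF v0 le dis']]
      by (simp add: blinfun.sum_right lessThan_Suc_atMost)
  qed
  then have "(\<lambda>k. blinfun_apply w (v k)) \<longlonglongrightarrow> 0" by (rule summable_LIMSEQ_zero)
  moreover have "norm (blinfun_apply \<phi> (y k)) \<le> blinfun_apply w (v k)" for k
    using dual_abs_le[OF w, of "y k"] dual_mono[OF w0 y[of k]] by simp
  ultimately show "(\<lambda>k. blinfun_apply \<phi> (y k)) \<longlonglongrightarrow> 0"
    by (metis (no_types, lifting) Lim_null_comparison always_eventually)
qed

section \<open>Moduli of disjoint L-sequences\<close>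

lemma norm_modulus_le:
  fixes f u :: "'a::banach_lattice \<Rightarrow>\<^sub>L real"
  assumes le: "f \<le> u" "- f \<le> u"
    and approx: "\<And>x e. 0 \<le> x \<Longrightarrow> 0 < e \<Longrightarrow> \<exists>y. \<bar>y\<bar> \<le> x \<and> blinfun_apply u x < blinfun_apply f y + e"
  shows "norm u \<le> norm f"
proof (rule norm_blinfun_bound)
  fix x
  have u0: "0 \<le> u" by (rule dual_modulus_nonneg[OF le])
  have "blinfun_apply u \<bar>x\<bar> \<le> norm f * norm x"
  proof (rule field_le_epsilon)
    fix e :: real assume "0 < e"
    then obtain y where y: "\<bar>y\<bar> \<le> \<bar>x\<bar>" "blinfun_apply u \<bar>x\<bar> < blinfun_apply f y + e"
      using approx[of "\<bar>x\<bar>" e] by auto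
    have "blinfun_apply f y \<le> norm f * norm y" using norm_blinfun[of f y] by simp
    also have "\<dots> \<le> norm f * norm x" by (intro mult_left_mono norm_mono_abs y) simp
    finally show "blinfun_apply u \<bar>x\<bar> \<le> norm f * norm x + e" using y by simp
  qed
  moreover have "\<bar>blinfun_apply u x\<bar> \<le> blinfun_apply u \<bar>x\<bar>"
    by (rule dual_abs_le) (use u0 in \<open>auto intro: order_trans[of _ 0]\<close>)
  ultimately show "norm (blinfun_apply u x) \<le> norm f * norm x" by simp
qed simp

text \<open>
  Pigeonhole step: among finitely many almost disjoint pieces of \<open>x\<close>, each \<open>u j\<close> must be small on
  one of them, and one piece serves infinitely many \<open>j\<close>.
\<close>

lemma disjoint_functionals_select:
  fixes u :: "nat \<Rightarrow> 'a::banach_lattice \<Rightarrow>\<^sub>L real"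
  assumes inf: "infinite M" and nn: "\<And>n. 0 \<le> u n"
    and split: "\<And>m n. m \<noteq> n \<Longrightarrow> dual_split (u m) (u n)"
    and x: "0 \<le> x" and C: "\<And>n. blinfun_apply (u n) x \<le> C" and e: "0 < e" and d: "0 < d"
  shows "\<exists>i\<in>M. \<exists>a. 0 \<le> a \<and> a \<le> x \<and> blinfun_apply (u i) (x - a) \<le> e \<and>
    infinite {j\<in>M. i < j \<and> blinfun_apply (u j) a \<le> d}"
proof -
  \<comment> \<open>With \<open>K\<close> pieces, a functional exceeding \<open>d\<close> on every
    piece would exceed its bound \<open>C\<close> at \<open>x\<close>.\<close>
  define K where "K = Suc (nat \<lceil>C / d\<rceil>)"
  have K: "C < real K * d"
  proof -
    have "C / d < real K" unfolding K_def by linarith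
    then show ?thesis using d by (simp add: field_simps)
  qed
  obtain F where F: "finite F" "card F = K" "F \<subseteq> M"
    using infinite_arbitrarily_large[OF inf] by blast
  have "\<exists>a. (\<forall>i\<in>F. 0 \<le> a i \<and> blinfun_apply (u i) (x - a i) \<le> e) \<and> sum a F \<le> x"
    by (rule disjoint_functionals_split_vector) (use F nn split x e in auto)
  then obtain a where a: "\<And>i. i \<in> F \<Longrightarrow> 0 \<le> a i" "\<And>i. i \<in> F \<Longrightarrow> blinfun_apply (u i) (x - a i) \<le> e"
    "sum a F \<le> x" by blast
  have "\<exists>i\<in>F. blinfun_apply (u j) (a i) \<le> d" for j
  proof (rule ccontr)
    assume "\<not> ?thesis"
    then have "of_nat (card F) * d \<le> (\<Sum>i\<in>F. blinfun_apply (u j) (a i))"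
      by (intro sum_bounded_below) auto
    also have "\<dots> = blinfun_apply (u j) (sum a F)" by (simp add: blinfun.sum_right)
    also have "\<dots> \<le> C" using dual_mono[OF nn a(3)] C order_trans by blast
    finally show False using K F by simp
  qed
  then have "M \<subseteq> (\<Union>i\<in>F. {j\<in>M. blinfun_apply (u j) (a i) \<le> d})" by auto
  then have "infinite (\<Union>i\<in>F. {j\<in>M. blinfun_apply (u j) (a i) \<le> d})"
    using inf finite_subset by blast
  then obtain i where i: "i \<in> F" "infinite {j\<in>M. blinfun_apply (u j) (a i) \<le> d}"
    using F(1) by auto
  \<comment> \<open>Discarding the finitely many indices up to \<open>i\<close> leaves an infinite
    set.\<close>
  have "{j\<in>M. blinfun_apply (u j) (a i) \<le> d} \<subseteq> {..i} \<union> {j\<in>M. i < j \<and> blinfun_apply (u j) (a i) \<le> d}"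
    by auto
  then have "infinite {j\<in>M. i < j \<and> blinfun_apply (u j) (a i) \<le> d}"
    using i(2) finite_subset by (metis (no_types, lifting) finite_Un finite_atMost)
  moreover have "a i \<le> x"
    using sum_mono2[of F "{i}" a] F(1) i(1) a(1,3) by auto
  ultimately show ?thesis using i(1) F(3) a(1,2) by blast
qed

text \<open>If the values stay above \<open>e\<close> infinitely often, pieces \<open>a k\<close> of
  \<open>x\<close> are selected so that \<open>u (r k)\<close> is concentrated on \<open>a k\<close>
  and later functionals are tiny there. Disjointification below \<open>x\<close> and near-attaining
  vectors \<open>y k\<close> then give a weakly null sequence contradicting
  \<open>L\<close>.\<close>

lemma disjoint_L_sequence_moduli_null:
  fixes f :: "nat \<Rightarrow> 'a::banach_lattice \<Rightarrow>\<^sub>L real"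
  assumes L: "L_sequence f" and lub: "\<And>n. isLub UNIV {f n, - f n} (u n)"
    and split: "\<And>m n. m \<noteq> n \<Longrightarrow> dual_split (u m) (u n)" and x: "0 \<le> x"
  shows "(\<lambda>n. blinfun_apply (u n) x) \<longlonglongrightarrow> 0"
proof (rule ccontr)
  assume not: "\<not> ?thesis"
  note ud = isLub_modulusD[OF lub]
  have nn: "0 \<le> u n" for n by (rule dual_modulus_nonneg[OF ud(1,2)])
  obtain B where B: "\<And>n. norm (f n) \<le> B" using L_sequence_bounded[OF L] by blast
  define C where "C = B * norm x"
  have C: "blinfun_apply (u n) x \<le> C" for n
  proof -
    have "norm (u n) \<le> norm (f n)"
      by (rule norm_modulus_le[OF ud(1,2)]) (rule isLub_modulus_approx[OF lub])
    then have "norm (u n) * norm x \<le> B * norm x"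
      using B[of n] by (intro mult_right_mono) auto
    then show ?thesis using norm_blinfun[of "u n" x] by (simp add: C_def)
  qed
  obtain e where e: "0 < e" "\<And>N. \<exists>n\<ge>N. e \<le> blinfun_apply (u n) x"
    using not dual_nonneg[OF nn x] unfolding LIMSEQ_iff by (force simp: not_less)
  define M0 where "M0 = {n. e \<le> blinfun_apply (u n) x}"
  have M0: "infinite M0"
    unfolding infinite_nat_iff_unbounded_le M0_def using e(2) by auto
  \<comment> \<open>A state holds the infinite reservoir \<open>M\<close> of indices still allowed,
    the chosen index \<open>i\<close> and its piece \<open>a\<close>. All of \<open>M\<close> lies
    beyond \<open>i\<close> and is nearly null on \<open>a\<close>, at a rate that beats the factor
    \<open>2 ^ k\<close> used later.\<close>
  define P where "P k s \<longleftrightarrow> (case s of (M, i, a) \<Rightarrow> infinite M \<and> M \<subseteq> M0 \<and> i \<in> M0 \<and> 0 \<le> a \<and> a \<le> x \<and>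
    blinfun_apply (u i) (x - a) \<le> e / 4 \<and> (\<forall>j\<in>M. i < j \<and> blinfun_apply (u j) a \<le> e / 8 * (1/4) ^ k))"
    for k :: nat and s :: "nat set \<times> nat \<times> 'a"
  define Q where "Q s s' \<longleftrightarrow> (case s of (M, _, _) \<Rightarrow> case s' of (M', i', _) \<Rightarrow> i' \<in> M \<and> M' \<subseteq> M)"
    for s s' :: "nat set \<times> nat \<times> 'a"
  have step: "\<exists>s. P k s \<and> (case s of (M', i', _) \<Rightarrow> i' \<in> M \<and> M' \<subseteq> M)"
    if M: "infinite M" "M \<subseteq> M0" for k M
  proof -
    obtain i a where ia: "i \<in> M" "0 \<le> a" "a \<le> x" "blinfun_apply (u i) (x - a) \<le> e / 4"
      "infinite {j\<in>M. i < j \<and> blinfun_apply (u j) a \<le> e / 8 * (1/4) ^ k}"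
      using disjoint_functionals_select[where u = u and e = "e / 4" and d = "e / 8 * (1/4) ^ k",
          OF M(1) nn split x C] e(1)
      by auto
    then show ?thesis
      using M(2) by (intro exI[of _ "({j\<in>M. i < j \<and> blinfun_apply (u j) a \<le> e / 8 * (1/4) ^ k}, i, a)"])
        (auto simp: P_def)
  qed
  have "\<exists>s. \<forall>k. P k (s k) \<and> Q (s k) (s (Suc k))"
  proof (rule dependent_nat_choice)
    show "\<exists>s. P 0 s" using step[OF M0] by blast
  next
    fix s :: "nat set \<times> nat \<times> 'a" and k assume Ps: "P k s"
    obtain M i a where s: "s = (M, i, a)" by (cases s)
    show "\<exists>s'. P (Suc k) s' \<and> Q s s'"
      using step[of M "Suc k"] Ps unfolding s by (auto simp: P_def Q_def)
  qed
  then obtain s where s: "\<And>k. P k (s k)" "\<And>k. Q (s k) (s (Suc k))" by blast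
  define M where "M k = fst (s k)" for k
  define r where "r k = fst (snd (s k))" for k
  define a where "a k = snd (snd (s k))" for k
  have seq: "r k \<in> M0" "0 \<le> a k" "a k \<le> x" "blinfun_apply (u (r k)) (x - a k) \<le> e / 4"
    "\<And>j. j \<in> M k \<Longrightarrow> blinfun_apply (u j) (a k) \<le> e / 8 * (1/4) ^ k"
    "r (Suc k) \<in> M k" "M (Suc k) \<subseteq> M k" for k
    using s[of k] by (auto simp: P_def Q_def M_def r_def a_def split: prod.splits)
  have small: "blinfun_apply (u (r k)) (a j) \<le> e / 8 * (1/4) ^ j" if jk: "j < k" for j k
  proof -
    obtain k' where k': "k = Suc k'" "j \<le> k'" using jk by (cases k) auto
    have "M k' \<subseteq> M j" by (rule lift_Suc_antimono_le[of M, OF seq(7) k'(2)])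
    then show ?thesis using seq(5)[of "r k" j] seq(6)[of k'] k' by auto
  qed
  \<comment> \<open>The weights \<open>2 ^ j\<close> and \<open>(1/2) ^ k\<close> meet the product
    condition with \<open>c = 1\<close>, since all pieces lie below \<open>x\<close>.\<close>
  define v where "v k = pprt (a k - (\<Sum>j<k. 2 ^ j *\<^sub>R a j) - (1/2) ^ k *\<^sub>R x)" for k
  have dis: "inf (v m) (v n) = 0" if "m < n" for m n
    by (rule disjointification[where a = a and w = x and c = "\<lambda>_. 1" and \<eta> = "\<lambda>k. (1/2) ^ k" and \<gamma> = "\<lambda>_ j. 2 ^ j"])
      (use seq x that in \<open>auto simp: v_def simp flip: power_mult_distrib\<close>)
  have vx: "v k \<le> x" for k
  proof -
    have "0 \<le> (\<Sum>j<k. 2 ^ j *\<^sub>R a j)" using seq by (intro sum_nonneg scaleR_nonneg_nonneg) auto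
    moreover have "0 \<le> (1/2) ^ k *\<^sub>R x" using x by (intro scaleR_nonneg_nonneg) auto
    ultimately have "a k - (\<Sum>j<k. 2 ^ j *\<^sub>R a j) - (1/2) ^ k *\<^sub>R x \<le> a k"
      by (simp add: algebra_simps add_nonneg_nonneg)
    then have "v k \<le> pprt (a k)" unfolding v_def by (rule pprt_mono)
    then show ?thesis using seq(2,3)[of k] by simp
  qed
  \<comment> \<open>From \<open>e\<close> one loses \<open>e / 4\<close> by passing from
    \<open>x\<close> to \<open>a k\<close>, at most \<open>e / 4\<close> by subtracting the earlier
    pieces, and a vanishing multiple of \<open>C\<close>.\<close>
  have big: "e / 2 \<le> blinfun_apply (u (r k)) (v k) + (1/2) ^ k * C" for k
  proof -
    have "blinfun_apply (u (r k)) (a k - (\<Sum>j<k. 2 ^ j *\<^sub>R a j) - (1/2) ^ k *\<^sub>R x)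
        \<le> blinfun_apply (u (r k)) (v k)"
      unfolding v_def by (intro dual_mono nn) (simp add: pprt_def)
    moreover have "(\<Sum>j<k. 2 ^ j * blinfun_apply (u (r k)) (a j)) \<le> e / 4"
    proof -
      have "(\<Sum>j<k. 2 ^ j * blinfun_apply (u (r k)) (a j)) \<le> (\<Sum>j<k. 2 ^ j * (e / 8 * (1/4) ^ j))"
        using small by (intro sum_mono mult_left_mono) auto
      also have "\<dots> = e / 8 * (\<Sum>j<k. (1/2) ^ j)"
        unfolding sum_distrib_left
        by (intro sum.cong refl) (simp add: power_divide flip: power_mult_distrib, simp add: field_simps flip: power_mult_distrib)
      also have "\<dots> \<le> e / 8 * 2"
        using e by (intro mult_left_mono) (auto simp: sum_gp_strict)
      finally show ?thesis by simp
    qed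
    moreover have "(1/2) ^ k * blinfun_apply (u (r k)) x \<le> (1/2) ^ k * C"
      using C by (intro mult_left_mono) auto
    moreover have "e \<le> blinfun_apply (u (r k)) x" using seq(1)[of k] by (simp add: M0_def)
    ultimately show ?thesis using seq(4)[of k]
      unfolding blinfun.diff_right blinfun.sum_right blinfun.scaleR_right real_scaleR_def by linarith
  qed
  have "\<exists>y. \<bar>y\<bar> \<le> v k \<and> blinfun_apply (u (r k)) (v k) < blinfun_apply (f (r k)) y + (1/2) ^ k" for k
    by (rule isLub_modulus_approx[OF lub]) (auto simp: v_def)
  then obtain y where y: "\<And>k. \<bar>y k\<bar> \<le> v k"
    "\<And>k. blinfun_apply (u (r k)) (v k) < blinfun_apply (f (r k)) (y k) + (1/2) ^ k" by metis
  have "weakly_null y" by (rule order_bounded_disjoint_weakly_null[OF dis vx y(1)])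
  then have "(\<lambda>k. blinfun_apply (f (r k)) (y k)) \<longlonglongrightarrow> 0" by (rule L_sequenceD[OF L])
  then have "(\<lambda>k. blinfun_apply (f (r k)) (y k) + (1/2) ^ k + (1/2) ^ k * C) \<longlonglongrightarrow> 0 + 0 + 0 * C"
    by (intro tendsto_intros LIMSEQ_power_zero) auto
  moreover have "e / 2 \<le> blinfun_apply (f (r k)) (y k) + (1/2) ^ k + (1/2) ^ k * C" for k
    using big[of k] y(2)[of k] by simp
  ultimately have "e / 2 \<le> 0 + 0 + 0 * C" by (intro LIMSEQ_le_const) auto
  then show False using e(1) by simp
qed

lemma weak_star_null_modulus:
  fixes f u :: "nat \<Rightarrow> 'a::banach_lattice \<Rightarrow>\<^sub>L real"
  assumes u: "\<And>x. 0 \<le> x \<Longrightarrow> (\<lambda>n. blinfun_apply (u n) x) \<longlonglongrightarrow> 0"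
    and le: "\<And>n. f n \<le> u n" "\<And>n. - f n \<le> u n"
  shows "weak_star_null f"
  unfolding weak_star_null_def
proof
  fix x
  show "(\<lambda>n. blinfun_apply (f n) x) \<longlonglongrightarrow> 0"
  proof (rule Lim_null_comparison)
    show "(\<lambda>n. blinfun_apply (u n) \<bar>x\<bar>) \<longlonglongrightarrow> 0" by (rule u) simp
    show "\<forall>\<^sub>F n in sequentially. norm (blinfun_apply (f n) x) \<le> blinfun_apply (u n) \<bar>x\<bar>"
      using dual_abs_le[OF le] by simp
  qed
qed

section \<open>Disjointly weakly compact operators\<close>

text \<open>The vectors are only norm bounded, so the dominating vector is the series of
  \<open>(1/2) ^ i *\<^sub>R a (r i)\<close>. Weak* nullness lets each chosen functional be small on
  the vectors chosen before it.\<close>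

lemma extract_disjoint:
  fixes u :: "nat \<Rightarrow> 'a::banach_lattice \<Rightarrow>\<^sub>L real"
  assumes nn: "\<And>n. 0 \<le> u n" and B: "\<And>n. norm (u n) \<le> B" and null: "weak_star_null u"
    and a: "\<And>n. 0 \<le> a n" and A: "\<And>n. norm (a n) \<le> A"
    and e: "0 < e" and ge: "\<And>n. e \<le> blinfun_apply (u n) (a n)"
  obtains r :: "nat \<Rightarrow> nat" and v where "\<And>m n. m < n \<Longrightarrow> inf (v m) (v n) = 0"
    "\<And>k. 0 \<le> v k" "\<And>k. v k \<le> a (r k)" "\<not> (\<lambda>k. blinfun_apply (u (r k)) (v k)) \<longlonglongrightarrow> 0"
proof -
  \<comment> \<open>The second component accumulates the vectors chosen so far;
    \<open>4 ^ Suc k\<close> is the coefficient with which they are subtracted at the next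
    stage.\<close>
  define Q where "Q k s s' \<longleftrightarrow> snd s' = snd s + a (fst s') \<and>
    blinfun_apply (u (fst s')) (4 ^ Suc k *\<^sub>R snd s) \<le> (1/2) ^ Suc k"
    for k :: nat and s s' :: "nat \<times> 'a"
  \<comment> \<open>The clause for \<open>k = 0\<close> initialises the accumulator and is vacuous
    afterwards.\<close>
  have "\<exists>s. \<forall>k. (k = 0 \<longrightarrow> snd (s k) = a (fst (s k))) \<and> Q k (s k) (s (Suc k))"
  proof (rule dependent_nat_choice)
    show "\<exists>s. (0::nat) = 0 \<longrightarrow> snd s = a (fst s)" by (intro exI[of _ "(0, a 0)"]) simp
  next
    fix s :: "nat \<times> 'a" and k
    have "(\<lambda>n. blinfun_apply (u n) (4 ^ Suc k *\<^sub>R snd s)) \<longlonglongrightarrow> 0"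
      using null unfolding weak_star_null_def by blast
    then have "\<forall>\<^sub>F n in sequentially. blinfun_apply (u n) (4 ^ Suc k *\<^sub>R snd s) < (1/2) ^ Suc k"
      by (rule order_tendstoD) simp
    then obtain n where "blinfun_apply (u n) (4 ^ Suc k *\<^sub>R snd s) < (1/2) ^ Suc k"
      unfolding eventually_sequentially by blast
    then show "\<exists>s'. (Suc k = 0 \<longrightarrow> snd s' = a (fst s')) \<and> Q k s s'"
      by (intro exI[of _ "(n, snd s + a n)"]) (simp add: Q_def)
  qed
  then obtain s where s0: "snd (s 0) = a (fst (s 0))" and s: "\<And>k. Q k (s k) (s (Suc k))" by metis
  define r where "r k = fst (s k)" for k
  have acc: "snd (s k) = (\<Sum>i<Suc k. a (r i))" for k
  proof (induction k)
    case 0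
    then show ?case using s0 by (simp add: r_def)
  next
    case (Suc k)
    then show ?case using s[of k] by (simp add: Q_def r_def)
  qed
  have small: "blinfun_apply (u (r k)) (\<Sum>i<k. 4 ^ k *\<^sub>R a (r i)) \<le> (1/2) ^ k" for k
  proof (cases k)
    case (Suc j)
    then show ?thesis using s[of j] acc[of j] by (simp only: Q_def r_def scaleR_sum_right)
  qed simp
  have sm: "summable (\<lambda>i. (1/2) ^ i *\<^sub>R a (r i))"
  proof (rule summable_norm_cancel, rule summable_comparison_test')
    show "summable (\<lambda>i. (1/2) ^ i * A)" by (intro summable_mult2 summable_geometric) simp
    show "norm (norm ((1/2) ^ i *\<^sub>R a (r i))) \<le> (1/2) ^ i * A" for i
      using A[of "r i"] by simp
  qed
  define w where "w = (\<Sum>i. (1/2) ^ i *\<^sub>R a (r i))"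
  have w: "(1/2) ^ k *\<^sub>R a (r k) \<le> w" for k
    unfolding w_def
    by (rule term_le_suminf[where g = "\<lambda>i. (1/2) ^ i *\<^sub>R a (r i)", OF sm]) (simp add: a scaleR_nonneg_nonneg)
  have w0: "0 \<le> w" using w[of 0] a[of "r 0"] by simp
  \<comment> \<open>Now \<open>c n = (1/2) ^ n\<close>, so the coefficient \<open>4 ^ n\<close> must
    outweigh \<open>(1/2) ^ m * (1/2) ^ n\<close>, which it does for \<open>m < n\<close>.\<close>
  define v where "v k = pprt (a (r k) - (\<Sum>i<k. 4 ^ k *\<^sub>R a (r i)) - (1/2) ^ k *\<^sub>R w)" for k
  have dis: "inf (v m) (v n) = 0" if "m < n" for m n
  proof (rule disjointification[where a = "\<lambda>k. a (r k)" and w = w and c = "\<lambda>k. (1/2) ^ k"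
        and \<eta> = "\<lambda>k. (1/2) ^ k" and \<gamma> = "\<lambda>k j. 4 ^ k", OF a w w0 _ _ _ v_def that])
    fix m n :: nat assume "m < n"
    then have "(2::real) ^ m * 2 ^ n \<le> 2 ^ n * 2 ^ n" by (intro mult_right_mono power_increasing) auto
    then show "1 \<le> 4 ^ n * ((1/2) ^ m * (1/2) ^ n :: real)"
      by (simp add: power_divide divide_simps flip: power_mult_distrib)
  qed auto
  have va: "v k \<le> a (r k)" for k
  proof -
    have "0 \<le> (\<Sum>i<k. 4 ^ k *\<^sub>R a (r i))" using a by (intro sum_nonneg scaleR_nonneg_nonneg) auto
    moreover have "0 \<le> (1/2) ^ k *\<^sub>R w" using w0 by (intro scaleR_nonneg_nonneg) auto
    ultimately have "a (r k) - (\<Sum>i<k. 4 ^ k *\<^sub>R a (r i)) - (1/2) ^ k *\<^sub>R w \<le> a (r k)"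
      by (simp add: algebra_simps add_nonneg_nonneg)
    then have "v k \<le> pprt (a (r k))" unfolding v_def by (rule pprt_mono)
    then show ?thesis using a by simp
  qed
  have "e \<le> blinfun_apply (u (r k)) (v k) + (1/2) ^ k + (1/2) ^ k * (B * norm w)" for k
  proof -
    have "blinfun_apply (u (r k)) (a (r k) - (\<Sum>i<k. 4 ^ k *\<^sub>R a (r i)) - (1/2) ^ k *\<^sub>R w)
        \<le> blinfun_apply (u (r k)) (v k)"
      unfolding v_def by (intro dual_mono nn) (simp add: pprt_def)
    moreover have "(1/2) ^ k * blinfun_apply (u (r k)) w \<le> (1/2) ^ k * (B * norm w)"
    proof (rule mult_left_mono)
      have "norm (u (r k)) * norm w \<le> B * norm w" by (intro mult_right_mono B) simp
      then show "blinfun_apply (u (r k)) w \<le> B * norm w" using norm_blinfun[of "u (r k)" w] by simp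
    qed simp
    ultimately show ?thesis using small[of k] ge[of "r k"]
      unfolding blinfun.diff_right blinfun.scaleR_right real_scaleR_def by linarith
  qed
  note lower = this
  have "\<not> (\<lambda>k. blinfun_apply (u (r k)) (v k)) \<longlonglongrightarrow> 0"
  proof
    assume "(\<lambda>k. blinfun_apply (u (r k)) (v k)) \<longlonglongrightarrow> 0"
    then have "(\<lambda>k. blinfun_apply (u (r k)) (v k) + (1/2) ^ k + (1/2) ^ k * (B * norm w))
        \<longlonglongrightarrow> 0 + 0 + 0 * (B * norm w)"
      by (intro tendsto_intros LIMSEQ_power_zero) auto
    then have "e \<le> 0 + 0 + 0 * (B * norm w)" using lower by (intro LIMSEQ_le_const) auto
    then show False using e by simp
  qed
  then show thesis using that[of v r] dis va by (simp add: v_def)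
qed

section \<open>Adjoints of disjointly weakly compact operators\<close>

lemma banach_adjoint_apply:
  "blinfun_apply (blinfun_apply (banach_adjoint T) f) x = blinfun_apply f (blinfun_apply T x)"
  by (simp add: banach_adjoint.rep_eq)

lemma norm_adjoint_not_null_witness:
  fixes f :: "nat \<Rightarrow> 'e::banach_lattice \<Rightarrow>\<^sub>L real" and T :: "'x::banach \<Rightarrow>\<^sub>L 'e"
  assumes "\<not> (\<lambda>n. norm (blinfun_apply (banach_adjoint T) (f n))) \<longlonglongrightarrow> 0"
  obtains e s x where "0 < e" "\<And>n. n \<le> s n" "\<And>n. norm (x n) \<le> 1"
    "\<And>n. e \<le> \<bar>blinfun_apply (f (s n)) (blinfun_apply T (x n))\<bar>"
proof -
  obtain e where e: "0 < e" "\<And>N. \<exists>n\<ge>N. e \<le> norm (blinfun_apply (banach_adjoint T) (f n))"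
    using assms unfolding LIMSEQ_iff by (force simp: not_less)
  have "\<exists>n x. N \<le> n \<and> norm x \<le> 1 \<and> e / 2 \<le> \<bar>blinfun_apply (f n) (blinfun_apply T x)\<bar>" for N
  proof -
    obtain n where n: "N \<le> n" "e \<le> norm (blinfun_apply (banach_adjoint T) (f n))"
      using e(2) by blast
    let ?g = "blinfun_apply (banach_adjoint T) (f n)"
    \<comment> \<open>The operator norm need not be attained, hence the passage to
      \<open>e / 2\<close>.\<close>
    have "\<exists>x. \<not> norm (blinfun_apply ?g x) \<le> e / 2 * norm x"
    proof (rule ccontr)
      assume "\<not> ?thesis"
      then have "norm ?g \<le> e / 2" using e(1) by (intro norm_blinfun_bound) auto
      then show False using n e(1) by simp
    qed
    then obtain x where x: "e / 2 * norm x < \<bar>blinfun_apply ?g x\<bar>" by (auto simp: not_le)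
    then have "x \<noteq> 0" by auto
    define z where "z = x /\<^sub>R norm x"
    have "\<bar>blinfun_apply ?g z\<bar> = \<bar>blinfun_apply ?g x\<bar> / norm x"
      by (simp add: z_def blinfun.scaleR_right abs_mult divide_inverse_commute)
    moreover have "e / 2 < \<bar>blinfun_apply ?g x\<bar> / norm x"
      using x \<open>x \<noteq> 0\<close> by (subst pos_less_divide_eq) simp_all
    ultimately have "e / 2 \<le> \<bar>blinfun_apply ?g z\<bar>" by simp
    then show ?thesis
      using n(1) \<open>x \<noteq> 0\<close> by (intro exI[of _ n] exI[of _ z]) (simp add: z_def banach_adjoint_apply)
  qed
  then obtain s x where "\<And>N. N \<le> s N" "\<And>N. norm (x N) \<le> 1"
    "\<And>N. e / 2 \<le> \<bar>blinfun_apply (f (s N)) (blinfun_apply T (x N))\<bar>" by metis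
  then show thesis using that[of "e / 2" s x] e(1) by simp
qed

text \<open>Common core of the implications from disjoint weak compactness. The disjoint
  \<open>v k\<close> lie below moduli of vectors in the image of the ball, so every sequence
  dominated by them is disjoint and lies in the solid hull of that image.\<close>

lemma disjointly_weakly_compact_extract:
  fixes f u :: "nat \<Rightarrow> 'e::banach_lattice \<Rightarrow>\<^sub>L real" and T :: "'x::banach \<Rightarrow>\<^sub>L 'e"
  assumes T: "disjointly_weakly_compact T"
    and not: "\<not> (\<lambda>n. norm (blinfun_apply (banach_adjoint T) (f n))) \<longlonglongrightarrow> 0"
    and le: "\<And>n. f n \<le> u n" "\<And>n. - f n \<le> u n" and B: "\<And>n. norm (u n) \<le> B"
    and null: "\<And>x. 0 \<le> x \<Longrightarrow> (\<lambda>n. blinfun_apply (u n) x) \<longlonglongrightarrow> 0"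
  obtains r :: "nat \<Rightarrow> nat" and v where "\<And>k. 0 \<le> v k"
    "\<And>y. \<forall>k. \<bar>y k\<bar> \<le> v k \<Longrightarrow> weakly_null y" "\<not> (\<lambda>k. blinfun_apply (u (r k)) (v k)) \<longlonglongrightarrow> 0"
proof -
  obtain e s x where w: "0 < e" "\<And>n. n \<le> s n" "\<And>n. norm (x n) \<le> 1"
    "\<And>n. e \<le> \<bar>blinfun_apply (f (s n)) (blinfun_apply T (x n))\<bar>"
    using norm_adjoint_not_null_witness[OF not] by blast
  have nn: "0 \<le> u n" for n by (rule dual_modulus_nonneg[OF le])
  have wu: "weak_star_null u"
    by (rule weak_star_null_modulus[OF null]) (use nn in \<open>auto intro: order_trans[of _ 0]\<close>)
  \<comment> \<open>Because \<open>n \<le> s n\<close>, weak* nullness survives reindexing by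
    \<open>s\<close>.\<close>
  have "filterlim s at_top sequentially"
    unfolding filterlim_at_top eventually_sequentially using w(2) order_trans by blast
  from filterlim_compose[OF _ this] have wus: "weak_star_null (\<lambda>n. u (s n))"
    using wu unfolding weak_star_null_def by blast
  have A: "norm \<bar>blinfun_apply T (x n)\<bar> \<le> norm T" for n
  proof -
    have "norm (blinfun_apply T (x n)) \<le> norm T * norm (x n)" by (rule norm_blinfun)
    also have "\<dots> \<le> norm T * 1" by (intro mult_left_mono w) simp
    finally show ?thesis by simp
  qed
  have ge: "e \<le> blinfun_apply (u (s n)) \<bar>blinfun_apply T (x n)\<bar>" for n
    using w(4)[of n] dual_abs_le[OF le] order_trans by blast
  obtain r v where rv: "\<And>m n. m < n \<Longrightarrow> inf (v m) (v n) = 0" "\<And>k. 0 \<le> v k"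
    "\<And>k. v k \<le> \<bar>blinfun_apply T (x (r k))\<bar>"
    "\<not> (\<lambda>k. blinfun_apply (u (s (r k))) (v k)) \<longlonglongrightarrow> 0"
    by (rule extract_disjoint[where u = "\<lambda>n. u (s n)" and a = "\<lambda>n. \<bar>blinfun_apply T (x n)\<bar>",
          OF nn B wus abs_ge_zero A w(1) ge])
      (rule that; assumption)
  have "weakly_null y" if "\<forall>k. \<bar>y k\<bar> \<le> v k" for y
  proof -
    have y: "\<bar>y k\<bar> \<le> v k" for k using that by blast
    have "disjoint_seq y" by (rule disjoint_seqI[OF rv(1) y])
    moreover have "range y \<subseteq> solid_hull (blinfun_apply T ` cball 0 1)"
    proof -
      have "\<bar>y k\<bar> \<le> \<bar>blinfun_apply T (x (r k))\<bar>" for k using y rv(3) by (rule order_trans)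
      then show ?thesis using w(3) by (auto simp: solid_hull_def intro!: bexI[of _ "x (r _)"])
    qed
    ultimately show ?thesis
      using T unfolding disjointly_weakly_compact_def disjointly_weakly_compact_set_def by blast
  qed
  then show thesis using that[of v "\<lambda>k. s (r k)"] rv by blast
qed

text \<open>Vectors \<open>y k\<close> below \<open>v k\<close> nearly attain the values of the
  moduli; they are weakly null, so the L-property drives these values to 0.\<close>

lemma disjointly_weakly_compact_L_sequence:
  fixes f u :: "nat \<Rightarrow> 'e::banach_lattice \<Rightarrow>\<^sub>L real" and T :: "'x::banach \<Rightarrow>\<^sub>L 'e"
  assumes T: "disjointly_weakly_compact T" and L: "L_sequence f"
    and lub: "\<And>n. isLub UNIV {f n, - f n} (u n)"
    and null: "\<And>x. 0 \<le> x \<Longrightarrow> (\<lambda>n. blinfun_apply (u n) x) \<longlonglongrightarrow> 0"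
  shows "(\<lambda>n. norm (blinfun_apply (banach_adjoint T) (f n))) \<longlonglongrightarrow> 0"
proof (rule ccontr)
  assume not: "\<not> ?thesis"
  note ud = isLub_modulusD[OF lub]
  obtain B where B: "\<And>n. norm (f n) \<le> B" using L_sequence_bounded[OF L] by blast
  have uB: "norm (u n) \<le> B" for n
    using norm_modulus_le[OF ud(1,2) isLub_modulus_approx[OF lub]] B order_trans by blast
  obtain r v where rv: "\<And>k. 0 \<le> v k" "\<And>y. \<forall>k. \<bar>y k\<bar> \<le> v k \<Longrightarrow> weakly_null y"
    "\<not> (\<lambda>k. blinfun_apply (u (r k)) (v k)) \<longlonglongrightarrow> 0"
    by (rule disjointly_weakly_compact_extract[OF T not ud(1,2) uB])
      (erule null, (rule that; assumption))
  have "\<exists>y. \<bar>y\<bar> \<le> v k \<and> blinfun_apply (u (r k)) (v k) < blinfun_apply (f (r k)) y + (1/2) ^ k" for k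
    by (rule isLub_modulus_approx[OF lub rv(1)]) simp
  then obtain y where y: "\<And>k. \<bar>y k\<bar> \<le> v k"
    "\<And>k. blinfun_apply (u (r k)) (v k) < blinfun_apply (f (r k)) (y k) + (1/2) ^ k" by metis
  have "(\<lambda>k. blinfun_apply (f (r k)) (y k)) \<longlonglongrightarrow> 0"
    by (rule L_sequenceD[OF L rv(2)]) (use y(1) in blast)
  then have lim: "(\<lambda>k. blinfun_apply (f (r k)) (y k) + (1/2) ^ k) \<longlonglongrightarrow> 0 + 0"
    by (intro tendsto_intros LIMSEQ_power_zero) auto
  have "(\<lambda>k. blinfun_apply (u (r k)) (v k)) \<longlonglongrightarrow> 0"
  proof (rule tendsto_sandwich[OF _ _ tendsto_const])
    show "\<forall>\<^sub>F k in sequentially. 0 \<le> blinfun_apply (u (r k)) (v k)"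
      using dual_nonneg[OF dual_modulus_nonneg[OF ud(1,2)] rv(1)] by simp
    show "\<forall>\<^sub>F k in sequentially. blinfun_apply (u (r k)) (v k) \<le> blinfun_apply (f (r k)) (y k) + (1/2) ^ k"
      using y(2) by (intro always_eventually allI less_imp_le)
    show "(\<lambda>k. blinfun_apply (f (r k)) (y k) + (1/2) ^ k) \<longlonglongrightarrow> 0" using lim by simp
  qed
  then show False using rv(3) by blast
qed

lemma isLub_nonneg:
  fixes f :: "'a::banach_lattice \<Rightarrow>\<^sub>L real"
  assumes "0 \<le> f"
  shows "isLub UNIV {f, - f} f"
  using dual_split_isLub[OF assms order_refl dual_split_0] by simp

lemma disjointly_weakly_compact_positive_L_sequence:
  fixes f :: "nat \<Rightarrow> 'e::banach_lattice \<Rightarrow>\<^sub>L real" and T :: "'x::banach \<Rightarrow>\<^sub>L 'e"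
  assumes "disjointly_weakly_compact T" "L_sequence f" "\<And>n. 0 \<le> f n" "weak_star_null f"
  shows "(\<lambda>n. norm (blinfun_apply (banach_adjoint T) (f n))) \<longlonglongrightarrow> 0"
  by (rule disjointly_weakly_compact_L_sequence[OF assms(1,2) isLub_nonneg[OF assms(3)]])
    (use assms(4) in \<open>simp add: weak_star_null_def\<close>)

text \<open>The extracted \<open>v\<close> is itself weakly null, so the common bound
  \<open>\<phi>\<close> squeezes the values of the \<open>f (r k)\<close> to 0.\<close>

lemma disjointly_weakly_compact_order_bounded:
  fixes f :: "nat \<Rightarrow> 'e::banach_lattice \<Rightarrow>\<^sub>L real" and T :: "'x::banach \<Rightarrow>\<^sub>L 'e"
  assumes T: "disjointly_weakly_compact T" and bd: "order_bounded (range f)"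
    and nn: "\<And>n. 0 \<le> f n" and null: "weak_star_null f"
  shows "(\<lambda>n. norm (blinfun_apply (banach_adjoint T) (f n))) \<longlonglongrightarrow> 0"
proof (rule ccontr)
  assume not: "\<not> ?thesis"
  obtain \<phi> where \<phi>: "0 \<le> \<phi>" "\<And>n. f n \<le> \<phi>" "\<And>n. - f n \<le> \<phi>"
    using order_bounded_dual_bound[OF bd] by blast
  have fB: "norm (f n) \<le> norm \<phi>" for n by (rule norm_dual_le[OF \<phi>(2,3)])
  have "- f n \<le> f n" for n using nn[of n] by (simp add: order_trans[of _ 0])
  note ff = this
  have lim: "(\<lambda>n. blinfun_apply (f n) x) \<longlonglongrightarrow> 0" for x
    using null by (simp add: weak_star_null_def)
  obtain r v where rv: "\<And>k. 0 \<le> v k" "\<And>y. \<forall>k. \<bar>y k\<bar> \<le> v k \<Longrightarrow> weakly_null y"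
    "\<not> (\<lambda>k. blinfun_apply (f (r k)) (v k)) \<longlonglongrightarrow> 0"
    by (rule disjointly_weakly_compact_extract[OF T not order_refl ff fB lim]) (rule that; assumption)
  have "weakly_null v" using rv(1) by (intro rv(2)) simp
  then have \<phi>v: "(\<lambda>k. blinfun_apply \<phi> (v k)) \<longlonglongrightarrow> 0" unfolding weakly_null_def by blast
  have "(\<lambda>k. blinfun_apply (f (r k)) (v k)) \<longlonglongrightarrow> 0"
  proof (rule tendsto_sandwich[OF _ _ tendsto_const \<phi>v])
    show "\<forall>\<^sub>F k in sequentially. 0 \<le> blinfun_apply (f (r k)) (v k)"
      using dual_nonneg[OF nn rv(1)] by simp
    show "\<forall>\<^sub>F k in sequentially. blinfun_apply (f (r k)) (v k) \<le> blinfun_apply \<phi> (v k)"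
      using dual_le[OF \<phi>(2) rv(1)] by simp
  qed
  then show False using rv(3) by blast
qed

section \<open>Components of a positive functional\<close>

lemma disjoint_seq_dualI:
  fixes f u :: "nat \<Rightarrow> 'e::banach_lattice \<Rightarrow>\<^sub>L real"
  assumes lub: "\<And>n. isLub UNIV {f n, - f n} (u n)"
    and split: "\<And>m n. m \<noteq> n \<Longrightarrow> dual_split (u m) (u n)"
  shows "disjoint_seq f"
proof -
  have nn: "0 \<le> u n" for n by (rule dual_modulus_nonneg[OF isLub_modulusD(1,2)[OF lub]])
  show ?thesis
    unfolding disjoint_seq_def lattice_disjoint_def
    using lub split dual_split_isGlb[OF nn nn] by metis
qed

text \<open>For positive \<open>c\<close>, the positive cone of the order ideal generated by
  \<open>c\<close>.\<close>

definition principal_cone :: "'a::banach_lattice \<Rightarrow> 'a set"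
  where "principal_cone c = {z. 0 \<le> z \<and> (\<exists>t>0. z \<le> t *\<^sub>R c)}"

lemma principal_cone_ideal:
  fixes c :: "'a::banach_lattice"
  assumes c: "0 \<le> c"
  shows "ideal_cone (principal_cone c)"
proof -
  have zero: "0 \<in> principal_cone c"
    unfolding principal_cone_def using c by (auto intro: exI[of _ 1])
  have add: "x + y \<in> principal_cone c" if xy: "x \<in> principal_cone c" "y \<in> principal_cone c" for x y
  proof -
    obtain t s where ts: "0 < t" "x \<le> t *\<^sub>R c" "0 < s" "y \<le> s *\<^sub>R c"
      using xy by (auto simp: principal_cone_def)
    have "x + y \<le> (t + s) *\<^sub>R c" using add_mono[OF ts(2,4)] by (simp add: scaleR_add_left)
    moreover have "0 < t + s" using ts by simp
    moreover have "0 \<le> x + y" using xy by (simp add: principal_cone_def)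
    ultimately show ?thesis unfolding principal_cone_def by blast
  qed
  have scale: "d *\<^sub>R x \<in> principal_cone c" if x: "x \<in> principal_cone c" and d: "0 < d" for x d
  proof -
    obtain t where t: "0 < t" "x \<le> t *\<^sub>R c" using x by (auto simp: principal_cone_def)
    have "d *\<^sub>R x \<le> (d * t) *\<^sub>R c" using scaleR_left_mono[OF t(2), of d] d by simp
    moreover have "0 < d * t" using d t by simp
    moreover have "0 \<le> d *\<^sub>R x"
      using x d by (intro scaleR_nonneg_nonneg) (auto simp: principal_cone_def)
    ultimately show ?thesis unfolding principal_cone_def by blast
  qed
  have down: "y \<in> principal_cone c" if "x \<in> principal_cone c" "0 \<le> y" "y \<le> x" for x y
    using that unfolding principal_cone_def mem_Collect_eq by (meson order_trans)
  show ?thesis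
    unfolding ideal_cone_def using zero add scale down by (auto simp: principal_cone_def)
qed

text \<open>A small positive multiple of \<open>z\<close> lies below both \<open>c\<close> and
  \<open>d\<close>, hence below their infimum 0.\<close>

lemma principal_cone_disjoint:
  fixes c :: "'a::banach_lattice"
  assumes z: "z \<in> principal_cone c" "z \<in> principal_cone d" and dis: "inf c d = 0"
  shows "z = 0"
proof -
  obtain t s where ts: "0 < t" "z \<le> t *\<^sub>R c" "0 < s" "z \<le> s *\<^sub>R d" and z0: "0 \<le> z"
    using z by (auto simp: principal_cone_def)
  define m where "m = inverse (max t s)"
  have m: "0 < m" "m * t \<le> 1" "m * s \<le> 1" using ts by (auto simp: m_def field_simps)
  have "0 \<le> c" "0 \<le> d" using dis by (metis inf.cobounded1, metis inf.cobounded2)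
  have "m *\<^sub>R z \<le> c"
  proof -
    have "m *\<^sub>R z \<le> (m * t) *\<^sub>R c" using scaleR_left_mono[OF ts(2), of m] m by simp
    also have "\<dots> \<le> 1 *\<^sub>R c" by (rule scaleR_right_mono[OF m(2) \<open>0 \<le> c\<close>])
    finally show ?thesis by simp
  qed
  moreover have "m *\<^sub>R z \<le> d"
  proof -
    have "m *\<^sub>R z \<le> (m * s) *\<^sub>R d" using scaleR_left_mono[OF ts(4), of m] m by simp
    also have "\<dots> \<le> 1 *\<^sub>R d" by (rule scaleR_right_mono[OF m(3) \<open>0 \<le> d\<close>])
    finally show ?thesis by simp
  qed
  ultimately have "m *\<^sub>R z \<le> 0" using dis by (metis inf.bounded_iff)
  moreover have "0 \<le> m *\<^sub>R z" using m z0 by (intro scaleR_nonneg_nonneg) auto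
  ultimately have "m *\<^sub>R z = 0" by (rule order_antisym)
  then show ?thesis using m by simp
qed

text \<open>The component of \<open>\<phi>\<close> in the band of functionals carried by \<open>c\<close>.\<close>

definition is_component :: "('a::banach_lattice \<Rightarrow>\<^sub>L real) \<Rightarrow> 'a \<Rightarrow> ('a \<Rightarrow>\<^sub>L real) \<Rightarrow> bool"
  where "is_component \<phi> c g \<longleftrightarrow> 0 \<le> g \<and> g \<le> \<phi> \<and>
    (\<forall>x z. z \<in> principal_cone c \<longrightarrow> z \<le> x \<longrightarrow> blinfun_apply \<phi> z \<le> blinfun_apply g x) \<and>
    (\<forall>x e. 0 \<le> x \<longrightarrow> 0 < e \<longrightarrow>
      (\<exists>z\<in>principal_cone c. z \<le> x \<and> blinfun_apply g x < blinfun_apply \<phi> z + e))"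

lemma component_exists:
  assumes \<phi>: "0 \<le> \<phi>" and c: "0 \<le> c"
  obtains g where "is_component \<phi> c g"
proof -
  obtain g where g: "\<And>x z. 0 \<le> x \<Longrightarrow> z \<in> principal_cone c \<Longrightarrow> z \<le> x \<Longrightarrow> blinfun_apply \<phi> z \<le> blinfun_apply g x"
    "\<And>x e. 0 \<le> x \<Longrightarrow> 0 < e \<Longrightarrow> \<exists>z\<in>principal_cone c. z \<le> x \<and> blinfun_apply g x < blinfun_apply \<phi> z + e"
    by (rule ideal_part_exists[OF principal_cone_ideal[OF c], of \<phi>]) (rule that; assumption)
  have zero: "0 \<in> principal_cone c"
    using principal_cone_ideal[OF c] by (simp add: ideal_cone_def)
  have g0: "0 \<le> g" using g(1)[OF _ zero] by (simp add: less_eq_blinfun_def)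
  have g\<phi>: "g \<le> \<phi>"
    unfolding less_eq_blinfun_def
  proof (intro allI impI)
    fix x :: 'a assume x: "0 \<le> x"
    show "blinfun_apply g x \<le> blinfun_apply \<phi> x"
    proof (rule field_le_epsilon)
      fix e :: real assume "0 < e"
      from g(2)[OF x this] obtain z where z: "z \<le> x" "blinfun_apply g x < blinfun_apply \<phi> z + e"
        by blast
      then show "blinfun_apply g x \<le> blinfun_apply \<phi> x + e" using dual_mono[OF \<phi> z(1)] by simp
    qed
  qed
  have "is_component \<phi> c g"
    unfolding is_component_def
  proof (intro conjI allI impI g0 g\<phi> g(2))
    fix x z assume z: "z \<in> principal_cone c" "z \<le> x"
    then have "0 \<le> x" by (auto simp: principal_cone_def intro: order_trans)
    then show "blinfun_apply \<phi> z \<le> blinfun_apply g x" using g(1) z by blast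
  qed
  then show thesis by (rule that)
qed

lemma component_vanishes:
  assumes g: "is_component \<phi> c g" and x: "x \<in> principal_cone d" and dis: "inf c d = 0"
  shows "blinfun_apply g x = 0"
proof -
  have x0: "0 \<le> x" using x by (simp add: principal_cone_def)
  have "blinfun_apply g x \<le> 0 + e" if e: "0 < e" for e
  proof -
    obtain z where z: "z \<in> principal_cone c" "z \<le> x" "blinfun_apply g x < blinfun_apply \<phi> z + e"
      using g x0 e unfolding is_component_def by blast
    have "z \<in> principal_cone d"
      using x z by (auto simp: principal_cone_def intro: order_trans)
    then have "z = 0" using principal_cone_disjoint[OF z(1) _ dis] by blast
    then show ?thesis using z by simp
  qed
  then have "blinfun_apply g x \<le> 0" using field_le_epsilon[of "blinfun_apply g x" 0] by blast
  moreover have "0 \<le> blinfun_apply g x"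
    using g x0 by (intro dual_nonneg) (simp_all add: is_component_def)
  ultimately show ?thesis by simp
qed

text \<open>A vector of the ideal of \<open>c\<close> that nearly attains \<open>g x\<close> leaves
  little of \<open>g\<close> on the remainder, while \<open>h\<close> vanishes on it.\<close>

lemma component_split:
  assumes g: "is_component \<phi> c g" and h: "is_component \<phi> d h" and dis: "inf c d = 0"
  shows "dual_split g h"
proof -
  have dis': "inf d c = 0" using dis by (simp add: inf_commute)
  have "\<exists>z. 0 \<le> z \<and> z \<le> x \<and> blinfun_apply h z + blinfun_apply g (x - z) < e"
    if xe: "0 \<le> x" "0 < e" for x e
  proof -
    obtain z where z: "z \<in> principal_cone c" "z \<le> x" "blinfun_apply g x < blinfun_apply \<phi> z + e"
      using g xe unfolding is_component_def by blast
    have "blinfun_apply \<phi> z \<le> blinfun_apply g z"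
      using g z(1) unfolding is_component_def by blast
    moreover have "blinfun_apply h z = 0" by (rule component_vanishes[OF h z(1) dis'])
    moreover have "0 \<le> z" using z(1) by (simp add: principal_cone_def)
    ultimately show ?thesis using z by (intro exI[of _ z]) (simp add: blinfun.diff_right)
  qed
  then have "dual_split h g" by (auto simp: dual_split_def)
  then show ?thesis by (rule dual_split_sym)
qed

text \<open>
  With \<open>\<bar>y n\<bar> \<le> \<bar>T (x n)\<bar>\<close>, take for \<open>p n\<close> and \<open>q n\<close> the components of \<open>\<phi>\<close> at
  \<open>inf \<bar>y n\<bar> (T (x n))\<^sup>+\<close> and \<open>inf \<bar>y n\<bar> (T (x n))\<^sup>-\<close>. The functional \<open>p n - q n\<close> compensates
  the signs of \<open>T (x n)\<close>, so its value there is at least \<open>\<phi> \<bar>y n\<bar>\<close>.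
\<close>

lemma not_disjointly_weakly_compact_components:
  fixes T :: "'x::banach \<Rightarrow>\<^sub>L 'e::banach_lattice"
  assumes "\<not> disjointly_weakly_compact T"
  obtains \<phi> and p q :: "nat \<Rightarrow> 'e \<Rightarrow>\<^sub>L real" where
    "\<And>n. 0 \<le> p n" "\<And>n. 0 \<le> q n" "\<And>n. p n \<le> \<phi>" "\<And>n. q n \<le> \<phi>"
    "\<And>m n. m \<noteq> n \<Longrightarrow> dual_split (p m) (p n)" "\<And>m n. m \<noteq> n \<Longrightarrow> dual_split (q m) (q n)"
    "\<And>m n. dual_split (p m) (q n)"
    "\<not> (\<lambda>n. norm (blinfun_apply (banach_adjoint T) (p n - q n))) \<longlonglongrightarrow> 0"
proof -
  have "bounded (blinfun_apply T ` cball 0 1)"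
    by (intro bounded_linear_image bounded_cball blinfun.bounded_linear_right)
  then obtain y where y: "disjoint_seq y" "range y \<subseteq> solid_hull (blinfun_apply T ` cball 0 1)"
    "\<not> weakly_null y"
    using assms unfolding disjointly_weakly_compact_def disjointly_weakly_compact_set_def by blast
  obtain \<psi> :: "'e \<Rightarrow>\<^sub>L real" where \<psi>: "\<not> (\<lambda>n. blinfun_apply \<psi> (y n)) \<longlonglongrightarrow> 0"
    using y(3) unfolding weakly_null_def by blast
  \<comment> \<open>A positive majorant bounds \<open>\<bar>\<psi> (y n)\<bar>\<close> by
    \<open>\<phi> \<bar>y n\<bar>\<close>, so it suffices to control the latter.\<close>
  obtain \<phi> where \<phi>: "\<psi> \<le> \<phi>" "- \<psi> \<le> \<phi>"
    by (rule dual_modulus_bound_exists[of \<psi>]) (rule that; assumption)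
  have \<phi>0: "0 \<le> \<phi>" by (rule dual_modulus_nonneg[OF \<phi>])
  have "\<exists>x. norm x \<le> 1 \<and> \<bar>y n\<bar> \<le> \<bar>blinfun_apply T x\<bar>" for n
  proof -
    have "y n \<in> solid_hull (blinfun_apply T ` cball 0 1)" using y(2) by blast
    then show ?thesis by (auto simp: solid_hull_def)
  qed
  then obtain x where x: "\<And>n. norm (x n) \<le> 1" "\<And>n. \<bar>y n\<bar> \<le> \<bar>blinfun_apply T (x n)\<bar>" by metis
  define t where "t n = blinfun_apply T (x n)" for n
  define c where "c n = inf \<bar>y n\<bar> (pprt (t n))" for n
  define d where "d n = inf \<bar>y n\<bar> (- nprt (t n))" for n
  have c0: "0 \<le> c n" and cy: "c n \<le> \<bar>y n\<bar>" and ct: "c n \<le> pprt (t n)"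
    and d0: "0 \<le> d n" and dy: "d n \<le> \<bar>y n\<bar>" and dt: "d n \<le> - nprt (t n)" for n
    by (simp_all add: c_def d_def)
  have ydis: "inf \<bar>y m\<bar> \<bar>y n\<bar> = 0" if "m \<noteq> n" for m n
    using y(1) that unfolding disjoint_seq_def lattice_disjoint_iff by metis
  have tdis: "inf (pprt (t n)) (- nprt (t n)) = 0" for n
    using inf_pprt_uminus[of "t n"] by (simp add: pprt_neg)
  have cc: "inf (c m) (c n) = 0" if "m \<noteq> n" for m n
    by (rule inf_eq_0_mono[OF ydis[OF that] c0 cy c0 cy])
  have dd: "inf (d m) (d n) = 0" if "m \<noteq> n" for m n
    by (rule inf_eq_0_mono[OF ydis[OF that] d0 dy d0 dy])
  have cd: "inf (c m) (d n) = 0" for m n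
  proof (cases "m = n")
    case True
    then show ?thesis using inf_eq_0_mono[OF tdis c0 ct d0 dt] by simp
  next
    case False
    show ?thesis by (rule inf_eq_0_mono[OF ydis[OF False] c0 cy d0 dy])
  qed
  have "\<exists>g. is_component \<phi> (c n) g" "\<exists>g. is_component \<phi> (d n) g" for n
    using component_exists[OF \<phi>0 c0] component_exists[OF \<phi>0 d0] by metis+
  then obtain p q where p: "\<And>n. is_component \<phi> (c n) (p n)" and q: "\<And>n. is_component \<phi> (d n) (q n)"
    by metis
  have pq: "0 \<le> p n" "p n \<le> \<phi>" "0 \<le> q n" "q n \<le> \<phi>" for n
    using p[of n] q[of n] by (simp_all add: is_component_def)
  have lower: "blinfun_apply \<phi> \<bar>y n\<bar> \<le> norm (blinfun_apply (banach_adjoint T) (p n - q n))" for n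
  proof -
    have self: "e \<in> principal_cone e" if "0 \<le> e" for e :: 'e
      using that by (auto simp: principal_cone_def intro: exI[of _ 1])
    have t: "t n = pprt (t n) - (- nprt (t n))" using prts[of "t n"] by simp
    have "blinfun_apply (p n) (- nprt (t n)) = 0"
    proof -
      have "inf (c n) (- nprt (t n)) = 0"
        by (rule inf_eq_0_mono[OF tdis c0 ct]) simp_all
      then show ?thesis by (intro component_vanishes[OF p self]) simp_all
    qed
    moreover have "blinfun_apply (q n) (pprt (t n)) = 0"
    proof -
      have "inf (pprt (t n)) (d n) = 0"
        by (rule inf_eq_0_mono[OF tdis _ _ d0 dt]) simp_all
      then show ?thesis by (intro component_vanishes[OF q self]) (simp_all add: inf_commute)
    qed
    moreover have "blinfun_apply \<phi> (c n) \<le> blinfun_apply (p n) (pprt (t n))"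
      using p[of n] self[OF c0] ct unfolding is_component_def by blast
    moreover have "blinfun_apply \<phi> (d n) \<le> blinfun_apply (q n) (- nprt (t n))"
      using q[of n] self[OF d0] dt unfolding is_component_def by blast
    \<comment> \<open>Since \<open>\<bar>y n\<bar>\<close> lies below the sum of the two parts of
      \<open>t n\<close>, subadditivity of the infimum applies.\<close>
    moreover have "\<bar>y n\<bar> \<le> c n + d n"
    proof -
      have "pprt (t n) + - nprt (t n) = \<bar>t n\<bar>" by (simp add: abs_prts)
      then have "\<bar>y n\<bar> = inf \<bar>y n\<bar> (pprt (t n) + - nprt (t n))"
        using x(2)[of n] by (simp add: t_def inf.absorb1)
      also have "\<dots> \<le> c n + d n" unfolding c_def d_def by (rule inf_add_le) simp_all
      finally show ?thesis .
    qed
    ultimately have "blinfun_apply \<phi> \<bar>y n\<bar> \<le> blinfun_apply (p n - q n) (t n)"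
    proof -
      assume *: "blinfun_apply (p n) (- nprt (t n)) = 0" "blinfun_apply (q n) (pprt (t n)) = 0"
        "blinfun_apply \<phi> (c n) \<le> blinfun_apply (p n) (pprt (t n))"
        "blinfun_apply \<phi> (d n) \<le> blinfun_apply (q n) (- nprt (t n))" "\<bar>y n\<bar> \<le> c n + d n"
      have "blinfun_apply \<phi> \<bar>y n\<bar> \<le> blinfun_apply \<phi> (c n) + blinfun_apply \<phi> (d n)"
        using dual_mono[OF \<phi>0 *(5)] by (simp add: blinfun.add_right)
      also have "\<dots> \<le> blinfun_apply (p n - q n) (pprt (t n)) - blinfun_apply (p n - q n) (- nprt (t n))"
        using * unfolding blinfun.diff_left by linarith
      also have "\<dots> = blinfun_apply (p n - q n) (t n)"
        using t by (metis blinfun.diff_right)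
      finally show ?thesis .
    qed
    also have "\<dots> = blinfun_apply (blinfun_apply (banach_adjoint T) (p n - q n)) (x n)"
      by (simp add: banach_adjoint_apply t_def)
    also have "\<dots> \<le> norm (blinfun_apply (banach_adjoint T) (p n - q n)) * norm (x n)"
      using norm_blinfun[of "blinfun_apply (banach_adjoint T) (p n - q n)" "x n"] by simp
    also have "\<dots> \<le> norm (blinfun_apply (banach_adjoint T) (p n - q n)) * 1"
      by (intro mult_left_mono x) simp
    finally show ?thesis by simp
  qed
  have "\<not> (\<lambda>n. norm (blinfun_apply (banach_adjoint T) (p n - q n))) \<longlonglongrightarrow> 0"
  proof
    assume lim: "(\<lambda>n. norm (blinfun_apply (banach_adjoint T) (p n - q n))) \<longlonglongrightarrow> 0"
    have "norm (blinfun_apply \<psi> (y n)) \<le> norm (blinfun_apply (banach_adjoint T) (p n - q n))" for n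
      using dual_abs_le[OF \<phi>, of "y n"] lower[of n] by simp
    then have "(\<lambda>n. blinfun_apply \<psi> (y n)) \<longlonglongrightarrow> 0"
      by (intro Lim_null_comparison[OF _ lim]) simp
    then show False using \<psi> by blast
  qed
  then show thesis
    using that[of p q \<phi>] pq component_split[OF p p cc] component_split[OF q q dd]
      component_split[OF p q cd] by blast
qed

section \<open>Assembling the equivalences\<close>

lemma disjoint_L_sequence_adjoint_null:
  fixes f :: "nat \<Rightarrow> 'e::banach_lattice \<Rightarrow>\<^sub>L real" and T :: "'x::banach \<Rightarrow>\<^sub>L 'e"
  assumes T: "disjointly_weakly_compact T" and f: "disjoint_seq f" "L_sequence f"
  shows "(\<lambda>n. norm (blinfun_apply (banach_adjoint T) (f n))) \<longlonglongrightarrow> 0"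
proof -
  obtain u where u: "\<And>n. isLub UNIV {f n, - f n} (u n)" "\<And>m n. m \<noteq> n \<Longrightarrow> dual_split (u m) (u n)"
    using disjoint_seq_moduli[OF f(1)] by blast
  show ?thesis
    by (rule disjointly_weakly_compact_L_sequence[OF T f(2) u(1)])
      (rule disjoint_L_sequence_moduli_null[OF f(2) u])
qed

lemma disjoint_L_sequence_weak_star_null:
  fixes f :: "nat \<Rightarrow> 'e::banach_lattice \<Rightarrow>\<^sub>L real"
  assumes f: "disjoint_seq f" "L_sequence f"
  shows "weak_star_null f"
proof -
  obtain u where u: "\<And>n. isLub UNIV {f n, - f n} (u n)" "\<And>m n. m \<noteq> n \<Longrightarrow> dual_split (u m) (u n)"
    using disjoint_seq_moduli[OF f(1)] by blast
  show ?thesis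
    by (rule weak_star_null_modulus[OF disjoint_L_sequence_moduli_null[OF f(2) u]])
      (auto intro: isLub_modulusD[OF u(1)])
qed

text \<open>One pair \<open>p\<close>, \<open>q\<close> refutes all the other conditions: the
  difference handles the disjoint ones, while \<open>p\<close> and \<open>q\<close> separately
  handle the positive ones.\<close>

lemma not_disjointly_weakly_compact_witness:
  fixes T :: "'x::banach \<Rightarrow>\<^sub>L 'e::banach_lattice"
  assumes "\<not> disjointly_weakly_compact T"
  obtains p q :: "nat \<Rightarrow> 'e \<Rightarrow>\<^sub>L real" where
    "\<And>n. 0 \<le> p n" "\<And>n. 0 \<le> q n" "order_bounded (range p)" "order_bounded (range q)"
    "disjoint_seq p" "disjoint_seq q"
    "order_bounded (range (\<lambda>n. p n - q n))" "disjoint_seq (\<lambda>n. p n - q n)"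
    "\<not> (\<lambda>n. norm (blinfun_apply (banach_adjoint T) (p n - q n))) \<longlonglongrightarrow> 0"
proof -
  obtain \<phi> and p q :: "nat \<Rightarrow> 'e \<Rightarrow>\<^sub>L real" where pq: "\<And>n. 0 \<le> p n" "\<And>n. 0 \<le> q n"
      "\<And>n. p n \<le> \<phi>" "\<And>n. q n \<le> \<phi>"
    and split: "\<And>m n. m \<noteq> n \<Longrightarrow> dual_split (p m) (p n)" "\<And>m n. m \<noteq> n \<Longrightarrow> dual_split (q m) (q n)"
      "\<And>m n. dual_split (p m) (q n)"
    and not: "\<not> (\<lambda>n. norm (blinfun_apply (banach_adjoint T) (p n - q n))) \<longlonglongrightarrow> 0"
    by (rule not_disjointly_weakly_compact_components[OF assms]) (rule that; assumption)
  have "order_bounded (range p)" "order_bounded (range q)"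
    using pq unfolding order_bounded_def by (metis atLeastAtMost_iff image_subsetI)+
  moreover have "order_bounded (range (\<lambda>n. p n - q n))"
  proof -
    have "p n - q n \<in> {- \<phi>..\<phi>}" for n
      using diff_mono[OF pq(3)[of n] pq(2)[of n]] diff_mono[OF pq(1)[of n] pq(4)[of n]] by simp
    then show ?thesis unfolding order_bounded_def by blast
  qed
  moreover have "disjoint_seq p"
    by (rule disjoint_seq_dualI[OF isLub_nonneg[OF pq(1)] split(1)])
  moreover have "disjoint_seq q"
    by (rule disjoint_seq_dualI[OF isLub_nonneg[OF pq(2)] split(2)])
  moreover have "disjoint_seq (\<lambda>n. p n - q n)"
  proof (rule disjoint_seq_dualI)
    show "isLub UNIV {p n - q n, - (p n - q n)} (p n + q n)" for n
      by (rule dual_split_isLub[OF pq(1,2) split(3)])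
    \<comment> \<open>The moduli of the differences are the sums; additivity in the second argument
      and symmetry reduce the claim to the four pairs.\<close>
    show "dual_split (p m + q m) (p n + q n)" if mn: "m \<noteq> n" for m n
    proof -
      have pqn: "0 \<le> p n + q n" using pq by (simp add: add_nonneg_nonneg)
      have "dual_split (p m) (p n + q n)"
        by (rule dual_split_add[OF pq(1) pq(1) pq(2) split(1)[OF mn] split(3)])
      moreover have "dual_split (q m) (p n + q n)"
        by (rule dual_split_add[OF pq(2) pq(1) pq(2) dual_split_sym[OF split(3)] split(2)[OF mn]])
      ultimately have "dual_split (p n + q n) (p m + q m)"
        by (intro dual_split_add[OF pqn pq(1) pq(2)]) (auto dest: dual_split_sym)
      then show ?thesis by (rule dual_split_sym)
    qed
  qed
  ultimately show thesis using that[of p q] pq not by blast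
qed

theorem theorem3p3:
  fixes T :: "'x::banach \<Rightarrow>\<^sub>L 'e::banach_lattice"
  shows
    "(disjointly_weakly_compact T \<longleftrightarrow>
      (\<forall>f :: nat \<Rightarrow> 'e \<Rightarrow>\<^sub>L real.
        order_bounded (range f) \<and> (\<forall>n. 0 \<le> f n) \<and> weak_star_null f \<longrightarrow>
        (\<lambda>n. norm (blinfun_apply (banach_adjoint T) (f n))) \<longlonglongrightarrow> 0)) \<and>
     (disjointly_weakly_compact T \<longleftrightarrow>
      (\<forall>f :: nat \<Rightarrow> 'e \<Rightarrow>\<^sub>L real.
        disjoint_seq f \<and> L_sequence f \<longrightarrow>
        (\<lambda>n. norm (blinfun_apply (banach_adjoint T) (f n))) \<longlonglongrightarrow> 0)) \<and>
     (\<forall>f :: nat \<Rightarrow> 'e \<Rightarrow>\<^sub>L real. disjoint_seq f \<and> L_sequence f \<longrightarrow> weak_star_null f) \<and>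
     (disjointly_weakly_compact T \<longleftrightarrow> almost_L_limited T) \<and>
     (disjointly_weakly_compact T \<longleftrightarrow>
      (\<forall>f :: nat \<Rightarrow> 'e \<Rightarrow>\<^sub>L real.
        order_bounded (range f) \<and> disjoint_seq f \<longrightarrow>
        (\<lambda>n. norm (blinfun_apply (banach_adjoint T) (f n))) \<longlonglongrightarrow> 0)) \<and>
     (disjointly_weakly_compact T \<longleftrightarrow> order_weakly_compact (banach_adjoint T)) \<and>
     (disjointly_weakly_compact T \<longleftrightarrow>
      (\<forall>f :: nat \<Rightarrow> 'e \<Rightarrow>\<^sub>L real.
        weak_star_null f \<and> L_sequence f \<and> (\<forall>n. 0 \<le> f n) \<longrightarrow>
        (\<lambda>n. norm (blinfun_apply (banach_adjoint T) (f n))) \<longlonglongrightarrow> 0))"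
proof -
  let ?null = "\<lambda>f. (\<lambda>n. norm (blinfun_apply (banach_adjoint T) (f n))) \<longlonglongrightarrow> 0"
  note L = order_bounded_disjoint_L_sequence and ws = disjoint_L_sequence_weak_star_null
  have diff: "?null (\<lambda>n. p n - q n)" if "?null p" "?null q" for p q
  proof -
    have "(\<lambda>n. blinfun_apply (banach_adjoint T) (p n) - blinfun_apply (banach_adjoint T) (q n)) \<longlonglongrightarrow> 0 - 0"
      using that by (intro tendsto_diff) (simp_all add: tendsto_norm_zero_iff)
    then show ?thesis by (simp add: blinfun.diff_right tendsto_norm_zero_iff)
  qed
  \<comment> \<open>The premise combines the restrictions of both conditions on positive sequences,
    so either condition implies it.\<close>
  have back2: "disjointly_weakly_compact T"
    if *: "\<And>f. order_bounded (range f) \<Longrightarrow> \<forall>n. 0 \<le> f n \<Longrightarrow> weak_star_null f \<Longrightarrow> L_sequence f \<Longrightarrow> ?null f"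
  proof (rule ccontr)
    assume "\<not> disjointly_weakly_compact T"
    then show False
    proof (rule not_disjointly_weakly_compact_witness)
      fix p q :: "nat \<Rightarrow> 'e \<Rightarrow>\<^sub>L real"
      assume pq: "\<And>n. 0 \<le> p n" "\<And>n. 0 \<le> q n" "order_bounded (range p)" "order_bounded (range q)"
        "disjoint_seq p" "disjoint_seq q" and not: "\<not> ?null (\<lambda>n. p n - q n)"
      have "?null p"
        by (rule *[OF pq(3) allI[OF pq(1)] ws[OF pq(5) L[OF pq(3,5)]] L[OF pq(3,5)]])
      moreover have "?null q"
        by (rule *[OF pq(4) allI[OF pq(2)] ws[OF pq(6) L[OF pq(4,6)]] L[OF pq(4,6)]])
      ultimately show False using diff not by blast
    qed
  qed
  \<comment> \<open>Likewise for disjoint sequences: the premise is implied by each of the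
    conditions on L-sequences and on order bounded sequences.\<close>
  have back3: "disjointly_weakly_compact T"
    if *: "\<And>f. order_bounded (range f) \<Longrightarrow> disjoint_seq f \<Longrightarrow> weak_star_null f \<Longrightarrow> L_sequence f \<Longrightarrow> ?null f"
  proof (rule ccontr)
    assume "\<not> disjointly_weakly_compact T"
    then show False
    proof (rule not_disjointly_weakly_compact_witness)
      fix p q :: "nat \<Rightarrow> 'e \<Rightarrow>\<^sub>L real"
      assume pq: "order_bounded (range (\<lambda>n. p n - q n))" "disjoint_seq (\<lambda>n. p n - q n)"
        and not: "\<not> ?null (\<lambda>n. p n - q n)"
      show False using *[OF pq ws[OF pq(2) L[OF pq]] L[OF pq]] not by blast
    qed
  qed
  have c2: "disjointly_weakly_compact T \<longleftrightarrow>
      (\<forall>f. order_bounded (range f) \<and> (\<forall>n. 0 \<le> f n) \<and> weak_star_null f \<longrightarrow> ?null f)"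
    using back2 disjointly_weakly_compact_order_bounded[of T] by blast
  have c3: "disjointly_weakly_compact T \<longleftrightarrow> (\<forall>f. disjoint_seq f \<and> L_sequence f \<longrightarrow> ?null f)"
    using back3 disjoint_L_sequence_adjoint_null[of T] by blast
  have c3': "disjointly_weakly_compact T \<longleftrightarrow> almost_L_limited T"
    unfolding almost_L_limited_def
    using back3 disjoint_L_sequence_adjoint_null[of T] by blast
  have c4: "disjointly_weakly_compact T \<longleftrightarrow>
      (\<forall>f. order_bounded (range f) \<and> disjoint_seq f \<longrightarrow> ?null f)"
    using back3 disjoint_L_sequence_adjoint_null[of T] L by blast
  have c5: "disjointly_weakly_compact T \<longleftrightarrow>
      (\<forall>f. weak_star_null f \<and> L_sequence f \<and> (\<forall>n. 0 \<le> f n) \<longrightarrow> ?null f)"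
    using back2 disjointly_weakly_compact_positive_L_sequence[of T] by blast
  show ?thesis
    unfolding order_weakly_compact_def by (intro conjI c2 c3 c3' c4 c5) (use ws in blast)
qed

end
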